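(* Let $0<a\le 1$. The function $\sigma\mapsto\zeta_2(\sigma,\sigma\,;a)$ has at least one real zero with $1/2<\sigma<1$. Hence there exist real numbers $\sigma_1,\sigma_2$ with $1/2<\sigma_1,\sigma_2<1$ such that $\zeta_2(\sigma_1,\sigma_2\,;a)=0$.
   Context: For $0<a\le 1$, the Hurwitz type of Euler-Zagier double zeta function is $$\zeta_2(s_1,s_2\,;a):=\sum_{m=0}^\infty\frac{1}{(m+a)^{s_1}}\sum_{n=1}^\infty\frac{1}{(m+n+a)^{s_2}},$$ where the series converges absolutely (for instance for $\Re(s_1)>1$, $\Re(s_2)>1$), and it is continued meromorphically in $(s_1,s_2)$ to $\mathbb{C}^2$; outside the region of convergence, $\zeta_2(s_1,s_2\,;a)$ denotes this continuation. *)

theory Defs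
  imports "HOL-Complex_Analysis.Complex_Analysis"
begin

section \<open>Holomorphic and meromorphic functions of two complex variables\<close>

text \<open>
  A function on an open subset of \<open>\<complex>\<^sup>2\<close> is holomorphic if it is continuous and
  holomorphic in each variable separately.
\<close>

definition holomorphic2_on ::
    "(complex \<times> complex \<Rightarrow> complex) \<Rightarrow> (complex \<times> complex) set \<Rightarrow> bool" where
  "holomorphic2_on f U \<longleftrightarrow>
     open U \<and> continuous_on U f \<and>
     (\<forall>w. (\<lambda>z. f (z, w)) holomorphic_on {z. (z, w) \<in> U}) \<and>
     (\<forall>z. (\<lambda>w. f (z, w)) holomorphic_on {w. (z, w) \<in> U})"

text \<open>
  A meromorphic function on \<open>\<complex>\<^sup>2\<close> is given by a holomorphic function \<open>f\<close> on a dense open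
  set \<open>D\<close> that near every point of \<open>\<complex>\<^sup>2\<close> is a quotient \<open>g / h\<close> of holomorphic functions,
  where \<open>h\<close> does not vanish identically. The set \<open>D\<close> need not be the largest possible
  domain of holomorphy, and the values of \<open>f\<close> outside \<open>D\<close> are irrelevant.
\<close>

definition meromorphic2 ::
    "(complex \<times> complex \<Rightarrow> complex) \<Rightarrow> (complex \<times> complex) set \<Rightarrow> bool" where
  "meromorphic2 f D \<longleftrightarrow>
     closure D = UNIV \<and> holomorphic2_on f D \<and>
     (\<forall>p. \<exists>V g h. open V \<and> connected V \<and> p \<in> V \<and>
        holomorphic2_on g V \<and> holomorphic2_on h V \<and> (\<exists>q\<in>V. h q \<noteq> 0) \<and>
        (\<forall>q\<in>V \<inter> D. f q * h q = g q))"


section \<open>The Hurwitz type Euler--Zagier double zeta function\<close>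

definition zeta2_series :: "real \<Rightarrow> complex \<Rightarrow> complex \<Rightarrow> complex" where
  "zeta2_series a s1 s2 =
     (\<Sum>m. 1 / complex_of_real (real m + a) powr s1 *
        (\<Sum>n. 1 / complex_of_real (real m + real (Suc n) + a) powr s2))"

definition zeta2_abs_conv :: "real \<Rightarrow> (complex \<times> complex) set" where
  "zeta2_abs_conv a =
     {(s1, s2). (\<lambda>(m, n). norm (1 / complex_of_real (real m + a) powr s1 *
                   (1 / complex_of_real (real m + real (Suc n) + a) powr s2)))
                summable_on (UNIV :: (nat \<times> nat) set)}"

definition zeta2_continuation ::
    "real \<Rightarrow> (complex \<times> complex \<Rightarrow> complex) \<Rightarrow> (complex \<times> complex) set \<Rightarrow> bool" where
  "zeta2_continuation a f D \<longleftrightarrow>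
     meromorphic2 f D \<and> zeta2_abs_conv a \<subseteq> D \<and>
     (\<forall>(s1, s2)\<in>zeta2_abs_conv a. f (s1, s2) = zeta2_series a s1 s2)"

text \<open>
  The points at which the meromorphic continuation is holomorphic. Any two continuations
  agree on the intersection of their domains by the identity theorem, so that the value
  \<open>zeta2 a s1 s2\<close> is determined at these points; elsewhere it is meaningless.
\<close>

definition zeta2_domain :: "real \<Rightarrow> (complex \<times> complex) set" where
  "zeta2_domain a = \<Union>{D. \<exists>f. zeta2_continuation a f D}"

definition zeta2 :: "real \<Rightarrow> complex \<Rightarrow> complex \<Rightarrow> complex" where
  "zeta2 a s1 s2 =
     (THE z. \<exists>f D. zeta2_continuation a f D \<and> (s1, s2) \<in> D \<and> z = f (s1, s2))"

end

theory Submission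
  imports Defs
begin

text \<open>
  Write \<open>\<zeta>(s)\<close> for the Hurwitz zeta function \<open>\<Sum>m\<ge>0. (m+a)\<^sup>-\<^sup>s\<close>. Splitting the pairs of indices in the
  product of two such series according to which index is larger gives the harmonic product
  \<open>\<zeta>(z) \<zeta>(w) = \<zeta>\<^sub>2(z,w) + \<zeta>\<^sub>2(w,z) + \<zeta>(z+w)\<close> (\<open>harmonic_product\<close>), and by analytic continuation it
  persists to the left of the region of convergence. On the diagonal it reads
  \<open>2 \<zeta>\<^sub>2(\<sigma>,\<sigma>) = \<zeta>(\<sigma>)\<^sup>2 - \<zeta>(2\<sigma>)\<close>. As \<open>\<sigma>\<close> decreases to \<open>1/2\<close> the right-hand side tends to \<open>-\<infinity>\<close> because
  of the pole of \<open>\<zeta>\<close> at \<open>1\<close>, and as \<open>\<sigma>\<close> increases to \<open>1\<close> it tends to \<open>+\<infinity>\<close> for the same reason; so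
  it vanishes somewhere in between. Clearing the poles turns this into the intermediate value theorem
  on a closed interval: with
  \<open>H(s) = (s-1) \<zeta>(s)\<close>, which is real on the positive axis and satisfies \<open>H(1) = 1\<close>, the function
  \<open>H(\<sigma>)\<^sup>2 (2\<sigma>-1) - H(2\<sigma>) (\<sigma>-1)\<^sup>2\<close> has the values \<open>-1/4\<close> and \<open>1\<close> at the two ends of the interval
  (\<open>zero_crossing\<close>).

  To make sense of the values at these points, one needs that a meromorphic continuation to all of
  \<open>\<complex>\<^sup>2\<close> exists and is unique. Uniqueness is the identity theorem (\<open>meromorphic2_eqI\<close>). For existence,
  consider the variant \<open>\<zeta>\<^sub>2\<^sup>\<star>(s\<^sub>1,s\<^sub>2) = \<zeta>\<^sub>2(s\<^sub>1,s\<^sub>2) + \<zeta>(s\<^sub>1+s\<^sub>2)\<close> in which the inner sum starts at the outer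
  index. Expanding \<open>(y+1)\<^sup>1\<^sup>-\<^sup>s\<close> by the binomial series in \<open>1/y\<close> and summing the telescoping differences
  \<open>y\<^sup>1\<^sup>-\<^sup>s - (y+1)\<^sup>1\<^sup>-\<^sup>s\<close> over \<open>y = m+a, m+a+1, \<dots>\<close> yields
  \<open>(s\<^sub>2-1) \<zeta>\<^sub>2\<^sup>\<star>(s\<^sub>1,s\<^sub>2) = \<zeta>(s\<^sub>1+s\<^sub>2-1) + \<Sum>k<K. c\<^sub>k(s\<^sub>2) \<zeta>\<^sub>2\<^sup>\<star>(s\<^sub>1,s\<^sub>2+k) + R\<^sub>K(s\<^sub>1,s\<^sub>2)\<close>, where \<open>k\<close> starts at \<open>1\<close>, the
  \<open>c\<^sub>k\<close> are polynomials, and the remainder \<open>R\<^sub>K\<close> is holomorphic on a region that grows with \<open>K\<close>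
  (\<open>zeta2_star_recursion\<close>). Every application of this identity moves the known domain of
  \<open>\<zeta>\<^sub>2\<^sup>\<star>\<close> one unit to the left, at the price of dividing by \<open>s\<^sub>2-1\<close>. The same
  argument with one sum instead of two continues \<open>\<zeta>\<close> itself (\<open>hurwitz_zeta_recursion\<close>).
\<close>

section \<open>Calculus of holomorphic functions of two variables\<close>

lemma holomorphic2_on_subset:
  assumes "holomorphic2_on f U" "open V" "V \<subseteq> U"
  shows "holomorphic2_on f V"
  using assms unfolding holomorphic2_on_def
  by (blast intro: continuous_on_subset holomorphic_on_subset)

lemma holomorphic2_on_add:
  assumes "holomorphic2_on f U" "holomorphic2_on g U"
  shows "holomorphic2_on (\<lambda>p. f p + g p) U"
  using assms unfolding holomorphic2_on_def by (auto intro!: continuous_intros holomorphic_intros)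

lemma holomorphic2_on_diff:
  assumes "holomorphic2_on f U" "holomorphic2_on g U"
  shows "holomorphic2_on (\<lambda>p. f p - g p) U"
  using assms unfolding holomorphic2_on_def by (auto intro!: continuous_intros holomorphic_intros)

lemma holomorphic2_on_mult:
  assumes "holomorphic2_on f U" "holomorphic2_on g U"
  shows "holomorphic2_on (\<lambda>p. f p * g p) U"
  using assms unfolding holomorphic2_on_def by (auto intro!: continuous_intros holomorphic_intros)

lemma holomorphic2_on_divide:
  assumes "holomorphic2_on f U" "holomorphic2_on g U" "\<And>p. p \<in> U \<Longrightarrow> g p \<noteq> 0"
  shows "holomorphic2_on (\<lambda>p. f p / g p) U"
  using assms unfolding holomorphic2_on_def by (auto intro!: continuous_intros holomorphic_intros)

lemma holomorphic2_on_const: "open U \<Longrightarrow> holomorphic2_on (\<lambda>p. c) U"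
  unfolding holomorphic2_on_def by auto

text \<open>
  The forms \<open>s\<^sub>1\<close>, \<open>s\<^sub>2\<close> and \<open>s\<^sub>1 + s\<^sub>2 + c\<close> are all affine, so this one rule turns every function of a
  single complex variable that occurs below into a holomorphic function of two variables.
\<close>

lemma holomorphic2_on_compose_affine:
  assumes F: "F holomorphic_on S" and U: "open U"
    and US: "\<And>z w. (z, w) \<in> U \<Longrightarrow> \<alpha> * z + \<beta> * w + \<gamma> \<in> S"
  shows "holomorphic2_on (\<lambda>p. F (\<alpha> * fst p + \<beta> * snd p + \<gamma>)) U"
  unfolding holomorphic2_on_def
proof (intro conjI allI)
  show "continuous_on U (\<lambda>p. F (\<alpha> * fst p + \<beta> * snd p + \<gamma>))"
    by (rule continuous_on_compose2[OF holomorphic_on_imp_continuous_on[OF F]])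
       (use US in \<open>auto intro!: continuous_intros\<close>)
  show "(\<lambda>z. F (\<alpha> * fst (z, w) + \<beta> * snd (z, w) + \<gamma>)) holomorphic_on {z. (z, w) \<in> U}" for w
    by (rule holomorphic_on_compose_gen[OF _ F, unfolded o_def])
       (use US in \<open>auto intro!: holomorphic_intros\<close>)
  show "(\<lambda>w. F (\<alpha> * fst (z, w) + \<beta> * snd (z, w) + \<gamma>)) holomorphic_on {w. (z, w) \<in> U}" for z
    by (rule holomorphic_on_compose_gen[OF _ F, unfolded o_def])
       (use US in \<open>auto intro!: holomorphic_intros\<close>)
qed (fact U)

lemma holomorphic2_on_swap:
  assumes "holomorphic2_on f U"
  shows "holomorphic2_on (\<lambda>p. f (snd p, fst p)) {p. (snd p, fst p) \<in> U}"
proof -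
  have U: "open U" and f: "continuous_on U f" using assms by (auto simp: holomorphic2_on_def)
  have op: "open {p. (snd p, fst p) \<in> U}"
    using open_vimage[OF U, of "\<lambda>p. (snd p, fst p)"]
    by (simp add: vimage_def continuous_on_Pair continuous_on_fst continuous_on_snd)
  have "continuous_on {p. (snd p, fst p) \<in> U} (\<lambda>p. f (snd p, fst p))"
    by (rule continuous_on_compose2[OF f]) (auto intro!: continuous_intros)
  with op assms show ?thesis by (auto simp: holomorphic2_on_def)
qed

lemma holomorphic2_on_shift_snd:
  assumes "holomorphic2_on f U"
  shows "holomorphic2_on (\<lambda>p. f (fst p, snd p + c)) {p. (fst p, snd p + c) \<in> U}"
proof -
  have U: "open U" and f: "continuous_on U f" using assms by (auto simp: holomorphic2_on_def)
  have op: "open {p. (fst p, snd p + c) \<in> U}"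
    using open_vimage[OF U, of "\<lambda>p. (fst p, snd p + c)"]
    by (simp add: vimage_def continuous_on_Pair continuous_on_fst continuous_on_snd continuous_on_add)
  have 1: "continuous_on {p. (fst p, snd p + c) \<in> U} (\<lambda>p. f (fst p, snd p + c))"
    by (rule continuous_on_compose2[OF f]) (auto intro!: continuous_intros)
  have 2: "(\<lambda>w. f (z, w + c)) holomorphic_on {w. (z, w + c) \<in> U}" for z
  proof -
    have "(\<lambda>w. f (z, w)) holomorphic_on {w. (z, w) \<in> U}" using assms by (auto simp: holomorphic2_on_def)
    then show ?thesis
      by (rule holomorphic_on_compose_gen[of "\<lambda>w. w + c", unfolded o_def, rotated])
         (auto intro!: holomorphic_intros)
  qed
  from op 1 2 assms show ?thesis by (auto simp: holomorphic2_on_def)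
qed

lemma holomorphic2_on_local:
  assumes "\<And>p. p \<in> U \<Longrightarrow> \<exists>V g. p \<in> V \<and> V \<subseteq> U \<and> holomorphic2_on g V \<and> (\<forall>q\<in>V. f q = g q)"
  shows "holomorphic2_on f U"
proof -
  have "\<exists>V. p \<in> V \<and> V \<subseteq> U \<and> holomorphic2_on f V" if "p \<in> U" for p
  proof -
    from assms[OF that] obtain V g
      where V: "p \<in> V" "V \<subseteq> U" "holomorphic2_on g V" "\<forall>q\<in>V. f q = g q" by blast
    have "continuous_on V f"
      using V by (simp add: holomorphic2_on_def cong: continuous_on_cong)
    moreover have "(\<lambda>z. f (z, w)) holomorphic_on {z. (z, w) \<in> V}" for w
      using V(3) holomorphic_transform[of "\<lambda>z. g (z, w)" "{z. (z, w) \<in> V}" "\<lambda>z. f (z, w)"] V(4)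
      by (auto simp: holomorphic2_on_def)
    moreover have "(\<lambda>z. f (w, z)) holomorphic_on {z. (w, z) \<in> V}" for w
      using V(3) holomorphic_transform[of "\<lambda>z. g (w, z)" "{z. (w, z) \<in> V}" "\<lambda>z. f (w, z)"] V(4)
      by (auto simp: holomorphic2_on_def)
    ultimately show ?thesis using V by (auto simp: holomorphic2_on_def)
  qed
  then obtain V where V: "\<And>p. p \<in> U \<Longrightarrow> p \<in> V p \<and> V p \<subseteq> U \<and> holomorphic2_on f (V p)" by metis
  have U: "U = (\<Union>p\<in>U. V p)" using V by blast
  have op: "open (V p)" if "p \<in> U" for p using V[OF that] by (auto simp: holomorphic2_on_def)
  have "open U" by (subst U) (use op in auto)
  moreover have "continuous_on U f"
    by (subst U, rule continuous_on_open_UN) (use V op in \<open>auto simp: holomorphic2_on_def\<close>)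
  moreover have "(\<lambda>z. f (z, w)) holomorphic_on {z. (z, w) \<in> U}" for w
  proof -
    have eq: "{z. (z, w) \<in> U} = (\<Union>p\<in>U. {z. (z, w) \<in> V p})" using V by auto
    have "open {z. (z, w) \<in> V p}" if "p \<in> U" for p
      using open_vimage[OF op[OF that], of "\<lambda>z. (z, w)"] by (simp add: vimage_def continuous_on_Pair)
    then show ?thesis unfolding eq
      by (intro holomorphic_on_UN_open) (use V in \<open>auto simp: holomorphic2_on_def\<close>)
  qed
  moreover have "(\<lambda>z. f (w, z)) holomorphic_on {z. (w, z) \<in> U}" for w
  proof -
    have eq: "{z. (w, z) \<in> U} = (\<Union>p\<in>U. {z. (w, z) \<in> V p})" using V by auto
    have "open {z. (w, z) \<in> V p}" if "p \<in> U" for p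
      using open_vimage[OF op[OF that], of "\<lambda>z. (w, z)"] by (simp add: vimage_def continuous_on_Pair)
    then show ?thesis unfolding eq
      by (intro holomorphic_on_UN_open) (use V in \<open>auto simp: holomorphic2_on_def\<close>)
  qed
  ultimately show ?thesis by (auto simp: holomorphic2_on_def)
qed

section \<open>The identity theorem in two variables\<close>

lemma polydisc_in_open:
  fixes U :: "(complex \<times> complex) set"
  assumes "open U" "p \<in> U"
  obtains r where "r > 0" "ball (fst p) r \<times> ball (snd p) r \<subseteq> U"
proof -
  from assms obtain A B where AB: "open A" "open B" "p \<in> A \<times> B" "A \<times> B \<subseteq> U"
    by (rule open_prod_elim)
  then have p: "fst p \<in> A" "snd p \<in> B" by auto
  obtain r1 where r1: "r1 > 0" "ball (fst p) r1 \<subseteq> A"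
    using AB(1) p(1) open_contains_ball by blast
  obtain r2 where r2: "r2 > 0" "ball (snd p) r2 \<subseteq> B"
    using AB(2) p(2) open_contains_ball by blast
  have "ball (fst p) (min r1 r2) \<times> ball (snd p) (min r1 r2) \<subseteq> A \<times> B"
    using r1 r2 by (intro Sigma_mono) (auto simp: subset_iff)
  with r1 r2 AB(4) show ?thesis by (intro that[of "min r1 r2"]) auto
qed

text \<open>
  The identity theorem in one variable is used twice: near \<open>q\<close> in the second coordinate, the zeros
  spread along the whole disc of the first coordinate; after that they spread in the second
  coordinate over every point of the first disc.
\<close>

lemma holomorphic2_zero_on_polydisc:
  assumes f: "holomorphic2_on f U" and sub: "ball z0 r \<times> ball w0 r \<subseteq> U"
    and q: "q \<in> ball z0 r \<times> ball w0 r" and W: "open W" "q \<in> W" "\<And>p. p \<in> W \<Longrightarrow> f p = 0"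
    and p: "p \<in> ball z0 r \<times> ball w0 r"
  shows "f p = 0"
proof -
  have "open (W \<inter> (ball z0 r \<times> ball w0 r))" "q \<in> W \<inter> (ball z0 r \<times> ball w0 r)"
    using W q by (auto intro!: open_Int open_Times)
  from polydisc_in_open[OF this] obtain \<epsilon>
    where \<epsilon>: "\<epsilon> > 0" "ball (fst q) \<epsilon> \<times> ball (snd q) \<epsilon> \<subseteq> W \<inter> (ball z0 r \<times> ball w0 r)" .
  then have \<epsilon>1: "ball (fst q) \<epsilon> \<subseteq> ball z0 r" and \<epsilon>2: "ball (snd q) \<epsilon> \<subseteq> ball w0 r"
    unfolding le_inf_iff times_subset_iff by simp_all
  have step1: "f (z, w) = 0" if z: "z \<in> ball z0 r" and w: "w \<in> ball (snd q) \<epsilon>" for z w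
  proof (rule analytic_continuation_open[where s = "ball (fst q) \<epsilon>" and s' = "ball z0 r"
        and f = "\<lambda>z. f (z, w)" and g = "\<lambda>_. 0"])
    have w': "w \<in> ball w0 r" using \<epsilon>2 w by blast
    have "(\<lambda>z. f (z, w)) holomorphic_on {z. (z, w) \<in> U}" using f by (auto simp: holomorphic2_on_def)
    then show "(\<lambda>z. f (z, w)) holomorphic_on ball z0 r"
      by (rule holomorphic_on_subset) (use sub w' in auto)
    show "ball (fst q) \<epsilon> \<subseteq> ball z0 r" by (fact \<epsilon>1)
    show "\<And>z. z \<in> ball (fst q) \<epsilon> \<Longrightarrow> f (z, w) = 0" using \<epsilon> w W(3) by blast
  qed (use \<epsilon> z in auto)
  have "f (z, w) = 0" if z: "z \<in> ball z0 r" and w: "w \<in> ball w0 r" for z w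
  proof (rule analytic_continuation_open[where s = "ball (snd q) \<epsilon>" and s' = "ball w0 r"
        and f = "\<lambda>w. f (z, w)" and g = "\<lambda>_. 0"])
    have "(\<lambda>w. f (z, w)) holomorphic_on {w. (z, w) \<in> U}" using f by (auto simp: holomorphic2_on_def)
    then show "(\<lambda>w. f (z, w)) holomorphic_on ball w0 r"
      by (rule holomorphic_on_subset) (use sub z in auto)
    show "ball (snd q) \<epsilon> \<subseteq> ball w0 r" by (fact \<epsilon>2)
    show "\<And>w. w \<in> ball (snd q) \<epsilon> \<Longrightarrow> f (z, w) = 0" using step1 z by blast
  qed (use \<epsilon> w in auto)
  then show ?thesis using p by (cases p) auto
qed

text \<open>
  The set of points near which \<open>f\<close> vanishes is open by definition, and it is closed in \<open>U\<close> because a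
  polydisc around a limit point meets it.
\<close>

lemma holomorphic2_identity:
  assumes f: "holomorphic2_on f U" and conn: "connected U"
    and W: "open W" "W \<noteq> {}" "W \<subseteq> U" "\<And>p. p \<in> W \<Longrightarrow> f p = 0" and p: "p \<in> U"
  shows "f p = 0"
proof -
  define Z where "Z = {p \<in> U. \<exists>W. open W \<and> p \<in> W \<and> W \<subseteq> U \<and> (\<forall>q\<in>W. f q = 0)}"
  have U: "open U" using f by (simp add: holomorphic2_on_def)
  have "openin (top_of_set U) Z"
  proof -
    have "Z = \<Union>{W. open W \<and> W \<subseteq> U \<and> (\<forall>q\<in>W. f q = 0)}" unfolding Z_def by blast
    then have "open Z" by (auto intro!: open_Union)
    then show ?thesis by (simp add: U Z_def openin_open_eq)
  qed
  moreover have "closedin (top_of_set U) Z"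
  proof -
    have "q \<in> Z" if q: "q \<in> U" "q \<in> closure Z" for q
    proof -
      obtain r where r: "r > 0" "ball (fst q) r \<times> ball (snd q) r \<subseteq> U"
        using polydisc_in_open[OF U q(1)] .
      let ?B = "ball (fst q) r \<times> ball (snd q) r"
      have qB: "open ?B" "q \<in> ?B" using r by (auto simp: open_Times mem_Times_iff)
      then obtain q' where q': "q' \<in> Z" "q' \<in> ?B"
        using q(2) by (metis IntE closure_iff_nhds_not_empty disjoint_iff order_refl)
      then obtain W where "open W" "q' \<in> W" "\<forall>q\<in>W. f q = 0" unfolding Z_def by blast
      then have "\<forall>p\<in>?B. f p = 0"
        using holomorphic2_zero_on_polydisc[OF f r(2) q'(2)] by blast
      then show "q \<in> Z" using qB q r unfolding Z_def by blast
    qed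
    then show ?thesis by (auto simp: closedin_limpt Z_def closure_def)
  qed
  moreover have "Z \<noteq> {}" using W unfolding Z_def by blast
  ultimately have "Z = U" using conn unfolding connected_clopen by blast
  with p show ?thesis unfolding Z_def by blast
qed

lemma holomorphic2_eqI:
  assumes "holomorphic2_on f U" "holomorphic2_on g U" "connected U"
    and "open W" "W \<noteq> {}" "W \<subseteq> U" "\<And>p. p \<in> W \<Longrightarrow> f p = g p" and p: "p \<in> U"
  shows "f p = g p"
  using holomorphic2_identity[OF holomorphic2_on_diff[OF assms(1,2)] assms(3,4,5,6) _ p] assms(7)
  by simp

lemma holomorphic2_nonzero_dense:
  assumes h: "holomorphic2_on h V" "connected V" "q \<in> V" "h q \<noteq> 0"
    and W: "open W" "W \<noteq> {}" "W \<subseteq> V"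
  shows "\<exists>p\<in>W. h p \<noteq> 0"
  using holomorphic2_identity[OF h(1,2) W _ h(3)] h(4) by blast

section \<open>Uniqueness of meromorphic continuation\<close>

lemma open_holomorphic2_nonzero:
  assumes "holomorphic2_on f U" shows "open {p \<in> U. f p \<noteq> 0}"
proof -
  have "open (U \<inter> f -` (- {0}))"
    using assms continuous_on_open_vimage[of U f] unfolding holomorphic2_on_def
    by (metis Int_commute open_Compl closed_singleton)
  then show ?thesis by (simp add: vimage_def Collect_conj_eq)
qed

text \<open>
  The domains \<open>D\<close> and \<open>D'\<close> may be disconnected, so the connectedness argument runs on all of \<open>\<complex>\<^sup>2\<close>:
  near a point outside the domains, \<open>f = g\<^sub>1 / h\<^sub>1\<close> and \<open>f' = g\<^sub>2 / h\<^sub>2\<close>, and agreement of the two quotients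
  is the vanishing of the holomorphic function \<open>g\<^sub>1 h\<^sub>2 - g\<^sub>2 h\<^sub>1\<close> on a polydisc.
\<close>

lemma meromorphic2_eqI:
  assumes f: "meromorphic2 f D" and f': "meromorphic2 f' D'"
    and W: "open W" "W \<noteq> {}" "W \<subseteq> D \<inter> D'" "\<And>p. p \<in> W \<Longrightarrow> f p = f' p"
    and p: "p \<in> D \<inter> D'"
  shows "f p = f' p"
proof -
  have D: "open D" "closure D = UNIV" "holomorphic2_on f D"
    and D': "open D'" "closure D' = UNIV" "holomorphic2_on f' D'"
    using f f' by (auto simp: meromorphic2_def holomorphic2_on_def)
  have dense: "V \<inter> (D \<inter> D') \<noteq> {}" if V: "open V" "V \<noteq> {}" for V
  proof -
    have "V \<inter> D \<noteq> {}" using V D(2) open_Int_closure_eq_empty by blast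
    then have "(V \<inter> D) \<inter> D' \<noteq> {}"
      using V D(1) D'(2) open_Int_closure_eq_empty[of "V \<inter> D" D'] by auto
    then show ?thesis by auto
  qed
  define Z where "Z = {p. \<exists>V. open V \<and> p \<in> V \<and> (\<forall>q\<in>V \<inter> (D \<inter> D'). f q = f' q)}"
  have "Z = \<Union>{V. open V \<and> (\<forall>q\<in>V \<inter> (D \<inter> D'). f q = f' q)}" unfolding Z_def by blast
  then have "open Z" by auto
  moreover have "closed Z"
  proof -
    have "p \<in> Z" if p: "p \<in> closure Z" for p
    proof -
      from f obtain V1 g1 h1 where 1: "open V1" "connected V1" "p \<in> V1" "holomorphic2_on g1 V1"
        "holomorphic2_on h1 V1" "\<exists>q\<in>V1. h1 q \<noteq> 0" "\<And>q. q \<in> V1 \<inter> D \<Longrightarrow> f q * h1 q = g1 q"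
        unfolding meromorphic2_def by metis
      from f' obtain V2 g2 h2 where 2: "open V2" "connected V2" "p \<in> V2" "holomorphic2_on g2 V2"
        "holomorphic2_on h2 V2" "\<exists>q\<in>V2. h2 q \<noteq> 0" "\<And>q. q \<in> V2 \<inter> D' \<Longrightarrow> f' q * h2 q = g2 q"
        unfolding meromorphic2_def by metis
      obtain r where r: "r > 0" "ball (fst p) r \<times> ball (snd p) r \<subseteq> V1 \<inter> V2"
        using polydisc_in_open[of "V1 \<inter> V2" p] 1 2 by blast
      define B where "B = ball (fst p) r \<times> ball (snd p) r"
      have B: "open B" "connected B" "p \<in> B" "B \<subseteq> V1" "B \<subseteq> V2"
        using r unfolding B_def
        by (auto intro!: open_Times convex_connected convex_Times simp: mem_Times_iff)
      obtain z where z: "z \<in> Z" "z \<in> B"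
        using p B by (metis closure_iff_nhds_not_empty disjoint_iff order_refl)
      then obtain V where V: "open V" "z \<in> V" "\<And>q. q \<in> V \<inter> (D \<inter> D') \<Longrightarrow> f q = f' q"
        unfolding Z_def by blast
      let ?W = "(V \<inter> B) \<inter> (D \<inter> D')"
      have W: "open ?W" "?W \<noteq> {}" using V B D D' z dense[of "V \<inter> B"] by blast+
      have eq: "g1 q * h2 q = g2 q * h1 q" if "q \<in> B" for q
      proof (rule holomorphic2_eqI[where W = ?W and U = B])
        show "g1 q * h2 q = g2 q * h1 q" if "q \<in> ?W" for q
        proof -
          have "f q = f' q" "f q * h1 q = g1 q" "f' q * h2 q = g2 q"
            using V(3)[of q] 1(7)[of q] 2(7)[of q] that B by auto
          then show ?thesis by (metis mult.assoc mult.commute)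
        qed
        show "holomorphic2_on (\<lambda>q. g1 q * h2 q) B" "holomorphic2_on (\<lambda>q. g2 q * h1 q) B"
          using 1 2 B by (auto intro!: holomorphic2_on_mult elim: holomorphic2_on_subset)
      qed (use W B that in auto)
      \<comment> \<open>The identity determines \<open>f\<close> and \<open>f'\<close> only where \<open>h1 * h2\<close> does not vanish. If they differed at
          a point, they would differ on an open set, and that set contains such a place.\<close>
      have "f q = f' q" if q: "q \<in> B \<inter> (D \<inter> D')" for q
      proof (rule ccontr)
        assume ne: "f q \<noteq> f' q"
        have "open (B \<inter> (D \<inter> D'))" using B D D' by auto
        then have "holomorphic2_on (\<lambda>q. f q - f' q) (B \<inter> (D \<inter> D'))"
          using D D' by (auto intro!: holomorphic2_on_diff elim: holomorphic2_on_subset)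
        from open_holomorphic2_nonzero[OF this]
        have "open {q \<in> B \<inter> (D \<inter> D'). f q - f' q \<noteq> 0}" (is "open ?N1") .
        moreover have "q \<in> ?N1" using q ne by auto
        ultimately obtain q1 where q1: "q1 \<in> ?N1" "h1 q1 \<noteq> 0"
          using holomorphic2_nonzero_dense[OF 1(5,2), of _ ?N1] 1(6) B by blast
        have "open (?N1 \<inter> {q \<in> V1. h1 q \<noteq> 0})" (is "open ?N2")
          using \<open>open ?N1\<close> open_holomorphic2_nonzero[OF 1(5)] by blast
        moreover have "q1 \<in> ?N2" using q1 B by auto
        ultimately obtain q2 where q2: "q2 \<in> ?N2" "h2 q2 \<noteq> 0"
          using holomorphic2_nonzero_dense[OF 2(5,2), of _ ?N2] 2(6) B by blast
        then have "f q2 * (h1 q2 * h2 q2) = f' q2 * (h1 q2 * h2 q2)"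
        proof -
          have "f q2 * h1 q2 = g1 q2" "f' q2 * h2 q2 = g2 q2" "g1 q2 * h2 q2 = g2 q2 * h1 q2"
            using eq[of q2] 1(7)[of q2] 2(7)[of q2] B q2 by auto
          then show ?thesis by (metis mult.assoc mult.commute)
        qed
        then show False using q2 by auto
      qed
      then show "p \<in> Z" using B unfolding Z_def by blast
    qed
    then show ?thesis by (metis closure_subset closure_closed subsetI subset_antisym closed_closure)
  qed
  moreover have "Z \<noteq> {}" using W unfolding Z_def by blast
  ultimately have "Z = UNIV" using connected_UNIV clopen by blast
  with p show ?thesis unfolding Z_def by blast
qed

section \<open>Infinite sums of holomorphic functions\<close>

lemma continuous_on_infsum:
  fixes T :: "'i \<Rightarrow> 'a::metric_space \<Rightarrow> complex"
  assumes U: "open U" and T: "\<And>i. i \<in> I \<Longrightarrow> continuous_on U (T i)"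
    and M: "\<And>p. p \<in> U \<Longrightarrow> \<exists>W M. open W \<and> p \<in> W \<and> M summable_on I \<and>
              (\<forall>i\<in>I. \<forall>q\<in>W \<inter> U. norm (T i q) \<le> M i)"
  shows "continuous_on U (\<lambda>q. \<Sum>\<^sub>\<infinity>i\<in>I. T i q)"
proof -
  have "continuous (at p) (\<lambda>q. \<Sum>\<^sub>\<infinity>i\<in>I. T i q)" if p: "p \<in> U" for p
  proof -
    from M[OF p] obtain W M where W: "open W" "p \<in> W" "M summable_on I"
      "\<And>i q. i \<in> I \<Longrightarrow> q \<in> W \<inter> U \<Longrightarrow> norm (T i q) \<le> M i" by blast
    have "continuous_on (W \<inter> U) (\<lambda>q. \<Sum>\<^sub>\<infinity>i\<in>I. T i q)"
    proof (rule uniform_limit_theorem)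
      show "uniform_limit (W \<inter> U) (\<lambda>F q. \<Sum>i\<in>F. T i q) (\<lambda>q. \<Sum>\<^sub>\<infinity>i\<in>I. T i q) (finite_subsets_at_top I)"
        using W(4,3) by (rule Weierstrass_m_test_general)
      have "continuous_on (W \<inter> U) (T i)" if "i \<in> I" for i
        using T[OF that] by (rule continuous_on_subset) auto
      then show "\<forall>\<^sub>F F in finite_subsets_at_top I. continuous_on (W \<inter> U) (\<lambda>q. \<Sum>i\<in>F. T i q)"
        by (intro eventually_finite_subsets_at_top_weakI continuous_on_sum) blast
    qed auto
    then show ?thesis using W U p by (simp add: continuous_on_eq_continuous_at open_Int)
  qed
  then show ?thesis by (auto intro: continuous_at_imp_continuous_on)
qed

lemma holomorphic_on_infsum:
  fixes T :: "'i \<Rightarrow> complex \<Rightarrow> complex"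
  assumes U: "open U" and T: "\<And>i. i \<in> I \<Longrightarrow> T i holomorphic_on U"
    and M: "\<And>p. p \<in> U \<Longrightarrow> \<exists>W M. open W \<and> p \<in> W \<and> M summable_on I \<and>
              (\<forall>i\<in>I. \<forall>q\<in>W \<inter> U. norm (T i q) \<le> M i)"
  shows "(\<lambda>q. \<Sum>\<^sub>\<infinity>i\<in>I. T i q) holomorphic_on U"
proof -
  have "(\<lambda>q. \<Sum>\<^sub>\<infinity>i\<in>I. T i q) field_differentiable (at p)" if p: "p \<in> U" for p
  proof -
    from M[OF p] obtain W M where W: "open W" "p \<in> W" "M summable_on I"
      "\<And>i q. i \<in> I \<Longrightarrow> q \<in> W \<inter> U \<Longrightarrow> norm (T i q) \<le> M i" by blast
    obtain r where r: "r > 0" "cball p r \<subseteq> W \<inter> U"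
      using open_contains_cball[of "W \<inter> U"] W U p by blast
    have Tr: "T i holomorphic_on cball p r" if "i \<in> I" for i
      using T[OF that] by (rule holomorphic_on_subset) (use r in auto)
    have lim: "uniform_limit (cball p r) (\<lambda>F q. \<Sum>i\<in>F. T i q) (\<lambda>q. \<Sum>\<^sub>\<infinity>i\<in>I. T i q)
            (finite_subsets_at_top I)"
      by (rule Weierstrass_m_test_general[OF _ W(3)]) (use W(4) r in blast)
    have "(\<lambda>q. \<Sum>i\<in>F. T i q) holomorphic_on cball p r" if "F \<subseteq> I" for F
      using Tr that by (intro holomorphic_on_sum) auto
    then have "\<forall>\<^sub>F F in finite_subsets_at_top I. continuous_on (cball p r) (\<lambda>q. \<Sum>i\<in>F. T i q) \<and>
           (\<lambda>q. \<Sum>i\<in>F. T i q) holomorphic_on ball p r"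
      by (intro eventually_finite_subsets_at_top_weakI conjI holomorphic_on_imp_continuous_on
            holomorphic_on_subset[OF _ ball_subset_cball]) blast+
    from holomorphic_uniform_limit[OF this lim]
    have "(\<lambda>q. \<Sum>\<^sub>\<infinity>i\<in>I. T i q) holomorphic_on ball p r" by auto
    then show ?thesis using r by (simp add: holomorphic_on_imp_differentiable_at)
  qed
  then show ?thesis by (auto simp: holomorphic_on_def intro: field_differentiable_at_within)
qed

lemma holomorphic2_on_infsum:
  assumes U: "open U" and T: "\<And>i. i \<in> I \<Longrightarrow> holomorphic2_on (T i) U"
    and M: "\<And>p. p \<in> U \<Longrightarrow> \<exists>W M. open W \<and> p \<in> W \<and> M summable_on I \<and>
              (\<forall>i\<in>I. \<forall>q\<in>W \<inter> U. norm (T i q) \<le> M i)"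
  shows "holomorphic2_on (\<lambda>q. \<Sum>\<^sub>\<infinity>i\<in>I. T i q) U"
  unfolding holomorphic2_on_def
proof (intro conjI allI)
  show "continuous_on U (\<lambda>q. \<Sum>\<^sub>\<infinity>i\<in>I. T i q)"
    using T by (intro continuous_on_infsum[OF U _ M]) (auto simp: holomorphic2_on_def)
  show "(\<lambda>z. \<Sum>\<^sub>\<infinity>i\<in>I. T i (z, w)) holomorphic_on {z. (z, w) \<in> U}" for w
  proof (rule holomorphic_on_infsum)
    have pre: "open {z. (z, w) \<in> W}" if "open W" for W :: "(complex \<times> complex) set"
      using open_vimage[OF that, of "\<lambda>z. (z, w)"] by (simp add: vimage_def continuous_on_Pair)
    then show "open {z. (z, w) \<in> U}" using U .
    fix z assume "z \<in> {z. (z, w) \<in> U}"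
    then obtain W M where W: "open W" "(z, w) \<in> W" "M summable_on I"
      "\<And>i q. i \<in> I \<Longrightarrow> q \<in> W \<inter> U \<Longrightarrow> norm (T i q) \<le> M i" using M[of "(z, w)"] by blast
    then show "\<exists>W M. open W \<and> z \<in> W \<and> M summable_on I \<and>
              (\<forall>i\<in>I. \<forall>q\<in>W \<inter> {z. (z, w) \<in> U}. norm (T i (q, w)) \<le> M i)"
      by (intro exI[of _ "{z. (z, w) \<in> W}"] exI[of _ M]) (auto simp: pre)
  qed (use T in \<open>auto simp: holomorphic2_on_def\<close>)
  show "(\<lambda>w. \<Sum>\<^sub>\<infinity>i\<in>I. T i (z, w)) holomorphic_on {w. (z, w) \<in> U}" for z
  proof (rule holomorphic_on_infsum)
    have pre: "open {w. (z, w) \<in> W}" if "open W" for W :: "(complex \<times> complex) set"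
      using open_vimage[OF that, of "\<lambda>w. (z, w)"] by (simp add: vimage_def continuous_on_Pair)
    then show "open {w. (z, w) \<in> U}" using U .
    fix w assume "w \<in> {w. (z, w) \<in> U}"
    then obtain W M where W: "open W" "(z, w) \<in> W" "M summable_on I"
      "\<And>i q. i \<in> I \<Longrightarrow> q \<in> W \<inter> U \<Longrightarrow> norm (T i q) \<le> M i" using M[of "(z, w)"] by blast
    then show "\<exists>W M. open W \<and> w \<in> W \<and> M summable_on I \<and>
              (\<forall>i\<in>I. \<forall>q\<in>W \<inter> {w. (z, w) \<in> U}. norm (T i (z, q)) \<le> M i)"
      by (intro exI[of _ "{w. (z, w) \<in> W}"] exI[of _ M]) (auto simp: pre)
  qed (use T in \<open>auto simp: holomorphic2_on_def\<close>)
qed (fact U)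

section \<open>Sums over shifted integers\<close>

lemma summable_on_shifted_powr:
  fixes a x :: real
  assumes "0 < a" "1 < x"
  shows "(\<lambda>n::nat. (real n + a) powr - x) summable_on UNIV"
proof -
  have "summable (\<lambda>n. real n powr - x)" using assms by (simp add: summable_real_powr_iff)
  then have "summable (\<lambda>n. (real n + a) powr - x)"
    by (rule summable_comparison_test'[where N = 1]) (use assms in \<open>auto intro!: powr_mono2'\<close>)
  then show ?thesis by (rule summable_nonneg_imp_summable_on) auto
qed

text \<open>
  The base \<open>x\<close> may be smaller than \<open>1\<close>, so that \<open>x powr - \<tau>\<close> is not monotone in a fixed direction; as
  \<open>x\<close> stays above \<open>a\<close> and \<open>\<tau>\<close> varies in an interval of length \<open>T\<close>, this costs only a constant factor.
\<close>

lemma powr_neg_le: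
  fixes a x b \<tau> T :: real
  assumes "0 < a" "a \<le> 1" "a \<le> x" "b \<le> \<tau>" "\<tau> \<le> b + T"
  shows "x powr - \<tau> \<le> a powr - T * x powr - b"
proof -
  have "x powr - \<tau> = x powr - (\<tau> - b) * x powr - b" by (simp flip: powr_add)
  also have "x powr - (\<tau> - b) \<le> a powr - (\<tau> - b)" using assms by (intro powr_mono2') auto
  also have "a powr - (\<tau> - b) \<le> a powr - T" using assms by (intro powr_mono') auto
  finally show ?thesis by (simp add: mult_right_mono)
qed

text \<open>
  The bound \<open>\<rho>(s, y) = O(y\<^sup>-\<^sup>s\<^sup>-\<^sup>K)\<close> for \<open>y \<ge> a\<close>, uniformly for \<open>s\<close> in bounded sets. It covers
  the general term \<open>y\<^sup>-\<^sup>s\<close> of the zeta series (\<open>K = 0\<close>) and the Taylor remainders that gain \<open>K\<close> powers.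
\<close>

definition decays :: "real \<Rightarrow> nat \<Rightarrow> (complex \<Rightarrow> real \<Rightarrow> complex) \<Rightarrow> bool" where
  "decays a K \<rho> \<longleftrightarrow> (\<forall>y\<ge>a. (\<lambda>s. \<rho> s y) holomorphic_on UNIV) \<and>
     (\<forall>R. \<exists>C\<ge>0. \<forall>s y. norm s \<le> R \<longrightarrow> a \<le> y \<longrightarrow> norm (\<rho> s y) \<le> C * y powr (- Re s - real K))"

text \<open>
  The region where double sums of terms \<open>(m+a)\<^sup>-\<^sup>s\<^sup>1 \<rho>(s\<^sub>2, m+n+a)\<close> with \<open>\<rho>\<close> decaying of order \<open>K\<close> converge.
  For \<open>K = 0\<close> it is the region of absolute convergence of the double zeta series.
\<close>

definition zeta_region :: "nat \<Rightarrow> (complex \<times> complex) set" where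
  "zeta_region K = {p. Re (snd p) > 1 - real K \<and> Re (fst p + snd p) > 2 - real K}"

lemma decays_single_bound:
  assumes a: "0 < a" "a \<le> 1" and \<rho>: "decays a K \<rho>" and s0: "Re s0 > 1 - real K"
  shows "\<exists>W M. open W \<and> s0 \<in> W \<and> M summable_on UNIV \<and>
           (\<forall>m. \<forall>s\<in>W. norm (\<rho> s (real m + a)) \<le> M m)"
proof -
  \<comment> \<open>On the disc of radius \<open>\<eta>\<close> around \<open>s0\<close> the exponent \<open>Re s + K\<close> lies between \<open>1 + \<eta>\<close> and \<open>1 + 3\<eta>\<close>.\<close>
  define \<eta> where "\<eta> = (Re s0 + real K - 1) / 2"
  have \<eta>: "\<eta> > 0" using s0 by (simp add: \<eta>_def)
  from \<rho> obtain C where C0: "C \<ge> 0" and C: "\<And>s y. norm s \<le> norm s0 + \<eta> \<Longrightarrow> a \<le> y \<Longrightarrow>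
      norm (\<rho> s y) \<le> C * y powr (- Re s - real K)" unfolding decays_def by blast
  have bd: "norm (\<rho> s (real m + a)) \<le> C * a powr - (2 * \<eta>) * (real m + a) powr - (1 + \<eta>)"
    if s: "s \<in> ball s0 \<eta>" for s m
  proof -
    have d: "norm (s - s0) < \<eta>" using s by (simp add: dist_norm norm_minus_commute)
    then have n: "norm s \<le> norm s0 + \<eta>" using norm_triangle_ineq[of s0 "s - s0"] by simp
    have "\<bar>Re s - Re s0\<bar> < \<eta>" using d abs_Re_le_cmod[of "s - s0"] by simp
    moreover have "Re s0 = 2 * \<eta> + 1 - real K" by (simp add: \<eta>_def field_simps)
    ultimately have "(real m + a) powr - (Re s + real K) \<le> a powr - (2 * \<eta>) * (real m + a) powr - (1 + \<eta>)"
      using a by (intro powr_neg_le) auto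
    moreover have "norm (\<rho> s (real m + a)) \<le> C * (real m + a) powr - (Re s + real K)"
      using C[OF n, of "real m + a"] a by simp
    ultimately show ?thesis using C0 by (smt (verit) mult_left_mono mult.assoc)
  qed
  have "(\<lambda>m. C * a powr - (2 * \<eta>) * (real m + a) powr - (1 + \<eta>)) summable_on UNIV"
    using a \<eta> by (intro summable_on_cmult_right summable_on_shifted_powr) auto
  with bd \<eta> show ?thesis
    by (intro exI[of _ "ball s0 \<eta>"] exI[of _ "\<lambda>m. C * a powr - (2 * \<eta>) * (real m + a) powr - (1 + \<eta>)"]) auto
qed

text \<open>
  With \<open>x = m+a\<close> and \<open>y = m+n+a\<close>, the summand is of size \<open>x powr - \<sigma>\<^sub>1 * y powr - (\<sigma>\<^sub>2+K)\<close>. A factor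
  \<open>y powr - (1+\<eta>)\<close> is at most \<open>(n+a) powr - (1+\<eta>)\<close>; in the rest of the power of \<open>y\<close>, whose exponent is still
  negative, \<open>y\<close> may be replaced by the smaller \<open>x\<close>. This leaves \<open>x\<close> with an exponent at most
  \<open>- (1+\<eta>)\<close>, so a product of two convergent single series is a majorant.
\<close>

lemma decays_double_bound:
  assumes a: "0 < a" "a \<le> 1" and \<rho>: "decays a K \<rho>" and p0: "p0 \<in> zeta_region K"
  shows "\<exists>W M. open W \<and> p0 \<in> W \<and> M summable_on UNIV \<and>
           (\<forall>mn. \<forall>p\<in>W. norm (case mn of (m, n) \<Rightarrow> complex_of_real (real m + a) powr - fst p *
                     \<rho> (snd p) (real m + real n + a)) \<le> M mn)"
proof -
  obtain z0 w0 where p0_eq: "p0 = (z0, w0)" by (cases p0)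
  define T where "T = Re z0 + Re w0 + real K - 2"
  \<comment> \<open>Moving both coordinates by less than \<open>\<eta>\<close> keeps \<open>Re w + K - 1\<close> above \<open>3\<eta>\<close> and
      \<open>Re z + Re w + K - 2\<close> above \<open>2\<eta>\<close>.\<close>
  define \<eta> where "\<eta> = min (Re w0 + real K - 1) T / 4"
  have \<eta>: "\<eta> > 0" "4 * \<eta> \<le> Re w0 + real K - 1" "4 * \<eta> \<le> T"
    using p0 by (auto simp: \<eta>_def T_def p0_eq zeta_region_def)
  from \<rho> obtain C where C0: "C \<ge> 0" and C: "\<And>s y. norm s \<le> norm w0 + \<eta> \<Longrightarrow> a \<le> y \<Longrightarrow>
      norm (\<rho> s y) \<le> C * y powr (- Re s - real K)" unfolding decays_def by blast
  define M where "M = (\<lambda>(m, n). (C * a powr - T) *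
      ((real m + a) powr - (1 + \<eta>) * (real n + a) powr - (1 + \<eta>)))"
  have bd: "norm (complex_of_real (real m + a) powr - z * \<rho> w (real m + real n + a)) \<le> M (m, n)"
    if z: "z \<in> ball z0 \<eta>" and w: "w \<in> ball w0 \<eta>" for z w m n
  proof -
    define x where "x = real m + a"
    define y where "y = real m + real n + a"
    have xy: "a \<le> x" "x \<le> y" "real n + a \<le> y" "0 < x" "0 < y" using a by (auto simp: x_def y_def)
    have dz: "norm (z - z0) < \<eta>" and dw: "norm (w - w0) < \<eta>"
      using z w by (simp_all add: dist_norm norm_minus_commute)
    then have n: "norm w \<le> norm w0 + \<eta>" using norm_triangle_ineq[of w0 "w - w0"] by simp
    have dz: "\<bar>Re z - Re z0\<bar> < \<eta>" using dz abs_Re_le_cmod[of "z - z0"] by simp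
    have dw: "\<bar>Re w - Re w0\<bar> < \<eta>" using dw abs_Re_le_cmod[of "w - w0"] by simp
    have ex: "- Re w - real K = - (Re w + real K)" by simp
    have "norm (complex_of_real x powr - z * \<rho> w y) = x powr - Re z * norm (\<rho> w y)"
      using xy by (simp add: norm_mult norm_powr_real_powr)
    also have "\<dots> \<le> x powr - Re z * (C * y powr - (Re w + real K))"
      using C[OF n, of y] xy unfolding ex by (intro mult_left_mono) auto
    also have "y powr - (Re w + real K) = y powr - (Re w + real K - 1 - \<eta>) * y powr - (1 + \<eta>)"
      unfolding powr_add[symmetric] by (rule arg_cong[of _ _ "\<lambda>t. y powr t"]) simp
    also have "x powr - Re z * (C * (y powr - (Re w + real K - 1 - \<eta>) * y powr - (1 + \<eta>))) \<le>
        x powr - Re z * (C * (x powr - (Re w + real K - 1 - \<eta>) * (real n + a) powr - (1 + \<eta>)))"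
      using xy dw \<eta> a C0 by (intro mult_left_mono mult_mono powr_mono2') auto
    also have "\<dots> = C * (x powr - (Re z + Re w + real K - 1 - \<eta>) * (real n + a) powr - (1 + \<eta>))"
      by (simp add: mult_ac powr_add[symmetric]) (simp add: algebra_simps)
    also have "x powr - (Re z + Re w + real K - 1 - \<eta>) \<le> a powr - T * x powr - (1 + \<eta>)"
      using a xy dz dw \<eta> by (intro powr_neg_le) (auto simp: T_def)
    finally show ?thesis
      using C0 by (simp add: M_def x_def y_def mult_ac mult_left_mono mult_right_mono)
  qed
  have "M summable_on UNIV"
  proof -
    have "(\<lambda>m. (real m + a) powr - (1 + \<eta>)) summable_on UNIV"
      using a \<eta> by (intro summable_on_shifted_powr) auto
    then have "(\<lambda>(m, n). (real m + a) powr - (1 + \<eta>) * (real n + a) powr - (1 + \<eta>))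
       summable_on (UNIV \<times> UNIV)"
      by (intro summable_on_SigmaI[where g = "\<lambda>m. (real m + a) powr - (1 + \<eta>) * (\<Sum>\<^sub>\<infinity>n. (real n + a) powr - (1 + \<eta>))"])
         (auto intro!: has_sum_cmult_right summable_on_cmult_left)
    then show ?thesis
      unfolding M_def by (simp only: case_prod_unfold UNIV_Times_UNIV) (intro summable_on_cmult_right)
  qed
  then show ?thesis using bd \<eta>(1)
    by (intro exI[of _ "ball z0 \<eta> \<times> ball w0 \<eta>"] exI[of _ M]) (auto simp: p0_eq intro!: open_Times)
qed

lemma open_zeta_region: "open (zeta_region K)"
proof -
  have "zeta_region K = {p. Re (snd p) > 1 - real K} \<inter> {p. Re (fst p + snd p) > 2 - real K}"
    by (auto simp: zeta_region_def)
  also have "open \<dots>" by (intro open_Int open_Collect_less continuous_intros)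
  finally show ?thesis .
qed

lemma convex_zeta_region: "convex (zeta_region K)"
proof -
  have "zeta_region K = (Re \<circ> snd) -` {1 - real K<..} \<inter> (\<lambda>p. Re (fst p + snd p)) -` {2 - real K<..}"
    by (auto simp: zeta_region_def)
  also have "convex \<dots>"
    by (intro convex_Int convex_linear_vimage)
       (auto intro!: linearI simp: algebra_simps)
  finally show ?thesis .
qed

lemma decays_single_holomorphic:
  assumes "0 < a" "a \<le> 1" "decays a K \<rho>"
  shows "(\<lambda>s. \<Sum>\<^sub>\<infinity>m. \<rho> s (real m + a)) holomorphic_on {s. Re s > 1 - real K}"
proof (rule holomorphic_on_infsum)
  show "open {s. 1 - real K < Re s}" by (simp add: open_halfspace_Re_gt)
  show "(\<lambda>s. \<rho> s (real i + a)) holomorphic_on {s. 1 - real K < Re s}" for i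
  proof -
    have "(\<lambda>s. \<rho> s (real i + a)) holomorphic_on UNIV"
      using assms(1,3) by (simp add: decays_def)
    then show ?thesis by (rule holomorphic_on_subset) simp
  qed
  show "\<exists>W M. open W \<and> p \<in> W \<and> M summable_on UNIV \<and>
      (\<forall>i\<in>UNIV. \<forall>s\<in>W \<inter> {s. 1 - real K < Re s}. norm (\<rho> s (real i + a)) \<le> M i)"
    if "p \<in> {s. 1 - real K < Re s}" for p
  proof -
    obtain W M where "open W" "p \<in> W" "M summable_on UNIV"
      "\<forall>m. \<forall>s\<in>W. norm (\<rho> s (real m + a)) \<le> M m"
      using decays_single_bound[OF assms, of p] \<open>p \<in> _\<close> by auto
    then show ?thesis by (intro exI[of _ W] exI[of _ M]) simp
  qed
qed

lemma decays_single_summable: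
  assumes "0 < a" "a \<le> 1" "decays a K \<rho>" "Re s > 1 - real K"
  shows "(\<lambda>m. \<rho> s (real m + a)) summable_on UNIV"
proof -
  from decays_single_bound[OF assms] obtain M
    where M: "M summable_on UNIV" "\<And>m. norm (\<rho> s (real m + a)) \<le> M m" by blast
  show ?thesis
    by (rule abs_summable_summable, rule summable_on_comparison_test[OF M(1)]) (use M(2) in auto)
qed

lemma decays_double_holomorphic:
  assumes a: "0 < a" "a \<le> 1" and \<rho>: "decays a K \<rho>"
  shows "holomorphic2_on (\<lambda>p. \<Sum>\<^sub>\<infinity>(m, n). complex_of_real (real m + a) powr - fst p *
                     \<rho> (snd p) (real m + real n + a)) (zeta_region K)"
proof (rule holomorphic2_on_infsum)
  show "holomorphic2_on (\<lambda>p. case mn of (m, n) \<Rightarrow> complex_of_real (real m + a) powr - fst p *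
                     \<rho> (snd p) (real m + real n + a)) (zeta_region K)" for mn
  proof -
    obtain m n where mn: "mn = (m, n)" by (cases mn)
    have 1: "(\<lambda>s. complex_of_real (real m + a) powr - s) holomorphic_on UNIV"
      using a by (auto intro!: holomorphic_intros)
    have 2: "(\<lambda>s. \<rho> s (real m + real n + a)) holomorphic_on UNIV"
      using a \<rho> unfolding decays_def by auto
    show ?thesis unfolding mn prod.case
      using holomorphic2_on_mult[OF holomorphic2_on_compose_affine[OF 1 open_zeta_region, of _ 1 0 0]
         holomorphic2_on_compose_affine[OF 2 open_zeta_region, of _ 0 1 0]] by simp
  qed
  show "\<exists>W M. open W \<and> p \<in> W \<and> M summable_on UNIV \<and>
      (\<forall>mn\<in>UNIV. \<forall>p\<in>W \<inter> zeta_region K. norm (case mn of (m, n) \<Rightarrow>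
          complex_of_real (real m + a) powr - fst p * \<rho> (snd p) (real m + real n + a)) \<le> M mn)"
    if p: "p \<in> zeta_region K" for p
  proof -
    obtain W M where "open W" "p \<in> W" "M summable_on UNIV"
      "\<forall>mn. \<forall>p\<in>W. norm (case mn of (m, n) \<Rightarrow>
          complex_of_real (real m + a) powr - fst p * \<rho> (snd p) (real m + real n + a)) \<le> M mn"
      by (rule exE[OF decays_double_bound[OF assms p]]) (elim exE conjE)
    then show ?thesis by (intro exI[of _ W] exI[of _ M]) simp
  qed
qed (fact open_zeta_region)

lemma decays_double_summable:
  assumes "0 < a" "a \<le> 1" "decays a K \<rho>" "p \<in> zeta_region K"
  shows "(\<lambda>(m, n). complex_of_real (real m + a) powr - fst p *
                     \<rho> (snd p) (real m + real n + a)) summable_on UNIV"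
proof -
  obtain W M where M: "p \<in> W" "M summable_on UNIV"
      "\<forall>mn. \<forall>p\<in>W. norm (case mn of (m, n) \<Rightarrow>
          complex_of_real (real m + a) powr - fst p * \<rho> (snd p) (real m + real n + a)) \<le> M mn"
    by (rule exE[OF decays_double_bound[OF assms]]) (elim exE conjE)
  show ?thesis
    by (rule abs_summable_summable, rule summable_on_comparison_test[OF M(2)])
       (rule M(3)[rule_format, OF M(1)], rule norm_ge_zero)
qed

section \<open>The Taylor remainder of a power\<close>

text \<open>
  \<open>(y+1)\<^sup>1\<^sup>-\<^sup>s\<close> minus the terms up to order \<open>K\<close> of its binomial expansion
  \<open>y\<^sup>1\<^sup>-\<^sup>s (1 + 1/y)\<^sup>1\<^sup>-\<^sup>s\<close> in powers of \<open>1/y\<close>.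
\<close>

definition taylor_tail :: "nat \<Rightarrow> complex \<Rightarrow> real \<Rightarrow> complex" where
  "taylor_tail K s y = complex_of_real (y + 1) powr (1 - s) -
     (\<Sum>k\<le>K. ((1 - s) gchoose k) * complex_of_real y powr (1 - s - of_nat k))"

text \<open>
  Taylor's formula on the real segment from \<open>0\<close> to \<open>b\<close> is used rather than the binomial series, because
  \<open>u = 1/y\<close> exceeds the radius of convergence \<open>1\<close> when \<open>y < 1\<close>, as happens at \<open>y = a\<close> if \<open>a < 1\<close>.
\<close>

lemma binomial_series_remainder:
  assumes b: "0 \<le> b" and w: "norm w \<le> R"
    and u: "0 \<le> u" "u \<le> b"
  shows "norm (complex_of_real (1 + u) powr w - (\<Sum>k\<le>K. (w gchoose k) * complex_of_real u ^ k))
           \<le> (R + real K) ^ Suc K * (1 + b) powr R * u ^ Suc K"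
proof -
  define S where "S = complex_of_real ` {0..b}"
  define c where "c = (\<lambda>k. \<Prod>j<k. w - of_nat j)"
  define f where "f = (\<lambda>k z. c k * (1 + z) powr (w - of_nat k))"
  have R: "R \<ge> 0" using w norm_ge_zero order_trans by blast
  have c: "c k = fact k * (w gchoose k)" for k
    by (simp add: c_def gbinomial_prod_rev lessThan_atLeast0)
  have pos: "1 + z \<notin> \<real>\<^sub>\<le>\<^sub>0" if "z \<in> S" for z
    using that by (auto simp: S_def complex_nonpos_Reals_iff)
  have "norm (f 0 (of_real u) - (\<Sum>i\<le>K. f i 0 * (of_real u - 0) ^ i / fact i))
          \<le> (R + real K) ^ Suc K * (1 + b) powr R * norm (of_real u - 0 :: complex) ^ Suc K / fact K"
  proof (rule complex_Taylor)
    show "convex S" unfolding S_def by (intro convex_linear_image bounded_linear.linear[OF bounded_linear_of_real]) simp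
    show "(f i has_field_derivative f (Suc i) z) (at z within S)" if "z \<in> S" for i z
    proof -
      have "(f i has_field_derivative c i * ((w - of_nat i) * (1 + z) powr (w - of_nat i - 1) * 1)) (at z within S)"
        unfolding f_def
        by (intro DERIV_cmult DERIV_chain2[OF has_field_derivative_powr] pos that)
           (auto intro!: derivative_eq_intros)
      also have "c i * ((w - of_nat i) * (1 + z) powr (w - of_nat i - 1) * 1) = f (Suc i) z"
        by (simp add: f_def c_def algebra_simps)
      finally show ?thesis .
    qed
    show "cmod (f (Suc K) z) \<le> (R + real K) ^ Suc K * (1 + b) powr R" if z: "z \<in> S" for z
    proof -
      obtain t where t: "z = of_real t" "0 \<le> t" "t \<le> b" using z by (auto simp: S_def)
      have "norm (c (Suc K)) \<le> (\<Prod>j<Suc K. R + real K)"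
        unfolding c_def prod_norm[symmetric]
      proof (intro prod_mono conjI norm_ge_zero)
        fix j assume "j \<in> {..<Suc K}"
        then show "norm (w - of_nat j) \<le> R + real K"
          using norm_triangle_ineq4[of w "of_nat j"] w by simp
      qed
      then have "norm (c (Suc K)) \<le> (R + real K) ^ Suc K" by simp
      moreover have "norm ((1 + z) powr (w - of_nat (Suc K))) \<le> (1 + b) powr R"
      proof -
        have "norm ((1 + z) powr (w - of_nat (Suc K))) = (1 + t) powr (Re w - real (Suc K))"
          using t norm_powr_real_powr[of "1 + t" "w - of_nat (Suc K)"] by simp
        also have "\<dots> \<le> (1 + t) powr R"
          using t complex_Re_le_cmod[of w] w by (intro powr_mono) auto
        also have "\<dots> \<le> (1 + b) powr R" using t R by (intro powr_mono2) auto
        finally show ?thesis .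
      qed
      ultimately show ?thesis unfolding f_def norm_mult
        using R by (intro mult_mono) auto
    qed
  qed (use b u in \<open>auto simp: S_def\<close>)
  also have "\<dots> \<le> (R + real K) ^ Suc K * (1 + b) powr R * u ^ Suc K"
  proof -
    have "x / fact K \<le> x" if "x \<ge> 0" for x :: real
      using that mult_left_mono[OF fact_ge_1[of K, where 'a = real], of x]
      by (simp add: divide_le_eq)
    then show ?thesis using u R by simp
  qed
  finally show ?thesis by (simp add: f_def c)
qed

lemma gchoose_holomorphic: "(\<lambda>s::complex. (1 - s) gchoose k) holomorphic_on UNIV"
  unfolding gbinomial_prod_rev by (intro holomorphic_intros) auto

lemma decays_taylor_tail:
  assumes a: "0 < a" 
  shows "decays a K (taylor_tail K)"
  unfolding decays_def
proof (intro conjI allI impI)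
  show "(\<lambda>s. taylor_tail K s y) holomorphic_on UNIV" if "a \<le> y" for y
  proof -
    show ?thesis
      unfolding taylor_tail_def using a that by (auto intro!: holomorphic_intros gchoose_holomorphic simp del: of_real_add simp flip: of_real_add)
  qed
  fix R
  define B where "B = (\<bar>R\<bar> + 1 + real K) ^ Suc K * (1 + 1 / a) powr (\<bar>R\<bar> + 1)"
  have "norm (taylor_tail K s y) \<le> B * y powr (- Re s - real K)" if s: "norm s \<le> R" and y: "a \<le> y" for s y
  proof -
    define u where "u = 1 / y"
    have y0: "0 < y" using a y by simp
    have u: "0 \<le> u" "u \<le> 1 / a" using a y by (auto simp: u_def field_simps)
    have n: "norm (1 - s) \<le> \<bar>R\<bar> + 1" using norm_triangle_ineq4[of 1 s] s by simp
    have 1: "complex_of_real (y + 1) powr (1 - s) = complex_of_real y powr (1 - s) * complex_of_real (1 + u) powr (1 - s)"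
    proof -
      have "complex_of_real (y + 1) = complex_of_real y * complex_of_real (1 + u)"
        using y0 by (simp add: u_def field_simps)
      then show ?thesis using y0 u by (simp add: powr_times_real del: of_real_add)
    qed
    have 2: "complex_of_real y powr (1 - s - of_nat k) = complex_of_real y powr (1 - s) * complex_of_real u ^ k" for k
    proof -
      have "complex_of_real y powr (1 - s - of_nat k) = complex_of_real y powr (1 - s) / complex_of_real y ^ k"
        using y0 by (simp add: powr_diff powr_nat)
      then show ?thesis by (simp add: u_def field_simps)
    qed
    have "taylor_tail K s y = complex_of_real y powr (1 - s) *
        (complex_of_real (1 + u) powr (1 - s) - (\<Sum>k\<le>K. ((1 - s) gchoose k) * complex_of_real u ^ k))"
      unfolding taylor_tail_def 1 2 by (simp add: algebra_simps sum_distrib_left)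
    also have "norm \<dots> \<le> y powr (1 - Re s) * (B * u ^ Suc K)"
      unfolding norm_mult B_def
      using binomial_series_remainder[OF _ n u, of K] y0 a
      by (intro mult_mono) (auto simp: norm_powr_real_powr add_ac)
    also have "\<dots> = B * (y powr (1 - Re s) * u ^ Suc K)" by simp
    also have "y powr (1 - Re s) * u ^ Suc K = y powr (- Re s - real K)"
    proof -
      have "u ^ Suc K = y powr - real (Suc K)"
        using y0 by (simp add: u_def powr_minus powr_realpow field_simps del: power_Suc of_nat_Suc)
      then have "y powr (1 - Re s) * u ^ Suc K = y powr (1 - Re s + - real (Suc K))" by (simp only: powr_add)
      then show ?thesis by simp
    qed
    finally show ?thesis .
  qed
  moreover have "B \<ge> 0" by (simp add: B_def)
  ultimately show "\<exists>C\<ge>0. \<forall>s y. norm s \<le> R \<longrightarrow> a \<le> y \<longrightarrow> norm (taylor_tail K s y) \<le> C * y powr (- Re s - real K)"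
    by blast
qed

lemma decays_powr:
  assumes "0 < a" shows "decays a 0 (\<lambda>s y. complex_of_real y powr - s)"
  unfolding decays_def
proof (intro conjI allI impI)
  show "(\<lambda>s. complex_of_real y powr - s) holomorphic_on UNIV" if "a \<le> y" for y
    using assms that by (auto intro!: holomorphic_intros)
  show "\<exists>C\<ge>0. \<forall>s y. norm s \<le> R \<longrightarrow> a \<le> y \<longrightarrow> norm (complex_of_real y powr - s) \<le> C * y powr (- Re s - real 0)" for R
    using assms by (intro exI[of _ 1]) (auto simp: norm_powr_real_powr)
qed

text \<open>
  The terms of order \<open>0\<close> and \<open>1\<close> of the expansion are \<open>y\<^sup>1\<^sup>-\<^sup>s\<close> and \<open>(1-s) y\<^sup>-\<^sup>s\<close>. Solving for the latter
  expresses \<open>y\<^sup>-\<^sup>s\<close> through a telescoping difference and faster decaying powers \<open>y\<^sup>-\<^sup>(\<^sup>s\<^sup>+\<^sup>k\<^sup>)\<close>.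
\<close>

lemma taylor_tail_identity:
  assumes "1 \<le> K"
  shows "(s - 1) * complex_of_real y powr - s =
     (complex_of_real y powr (1 - s) - complex_of_real (y + 1) powr (1 - s)) +
     (\<Sum>k=1..<K. ((1 - s) gchoose Suc k) * complex_of_real y powr - (s + of_nat k)) + taylor_tail K s y"
proof -
  have "{..K} = {0, 1} \<union> Suc ` {1..<K}"
    using assms by (auto simp: image_Suc_atLeastLessThan)
  then have "(\<Sum>k\<le>K. ((1 - s) gchoose k) * complex_of_real y powr (1 - s - of_nat k)) =
     (\<Sum>k\<in>{0,1}. ((1 - s) gchoose k) * complex_of_real y powr (1 - s - of_nat k)) +
     (\<Sum>k\<in>Suc ` {1..<K}. ((1 - s) gchoose k) * complex_of_real y powr (1 - s - of_nat k))"
    by (simp only:) (rule sum.union_disjoint, auto)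
  also have "(\<Sum>k\<in>Suc ` {1..<K}. ((1 - s) gchoose k) * complex_of_real y powr (1 - s - of_nat k)) =
      (\<Sum>k=1..<K. ((1 - s) gchoose Suc k) * complex_of_real y powr - (s + of_nat k))"
    by (subst sum.reindex) (auto intro!: sum.cong simp: algebra_simps)
  finally show ?thesis unfolding taylor_tail_def by (simp add: algebra_simps)
qed

section \<open>Recursions for the Hurwitz and the double zeta function\<close>

definition hurwitz_zeta :: "real \<Rightarrow> complex \<Rightarrow> complex" where
  "hurwitz_zeta a s = (\<Sum>\<^sub>\<infinity>m. complex_of_real (real m + a) powr - s)"

text \<open>
  The inner sum includes \<open>n = 0\<close>. With this choice the telescoping inner sum starts at the
  same argument \<open>m+a\<close> as the outer factor, so that the boundary terms add up to a Hurwitz zeta value.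
\<close>

definition zeta2_star :: "real \<Rightarrow> complex \<times> complex \<Rightarrow> complex" where
  "zeta2_star a p = (\<Sum>\<^sub>\<infinity>(m, n). complex_of_real (real m + a) powr - fst p *
                complex_of_real (real m + real n + a) powr - snd p)"

lemma hurwitz_zeta_has_sum:
  assumes "0 < a" "a \<le> 1" "Re s > 1"
  shows "((\<lambda>m. complex_of_real (real m + a) powr - s) has_sum hurwitz_zeta a s) UNIV"
  unfolding hurwitz_zeta_def
  by (rule has_sum_infsum, rule decays_single_summable[OF assms(1,2) decays_powr[OF assms(1)]])
     (use assms in simp)

lemma zeta2_star_has_sum:
  assumes "0 < a" "a \<le> 1" "(s1, s2) \<in> zeta_region 0"
  shows "((\<lambda>(m, n). complex_of_real (real m + a) powr - s1 *
                complex_of_real (real m + real n + a) powr - s2) has_sum zeta2_star a (s1, s2)) (UNIV \<times> UNIV)"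
  using has_sum_infsum[OF decays_double_summable[OF assms(1,2) decays_powr[OF assms(1)] assms(3)]]
  by (simp add: zeta2_star_def)

lemma has_sum_finite_sum:
  fixes f :: "'i \<Rightarrow> 'a \<Rightarrow> 'b::{topological_comm_monoid_add}"
  assumes "finite F" "\<And>k. k \<in> F \<Longrightarrow> (f k has_sum S k) A"
  shows "((\<lambda>x. \<Sum>k\<in>F. f k x) has_sum (\<Sum>k\<in>F. S k)) A"
  using assms by (induction rule: finite_induct) (auto intro: has_sum_add)

lemma has_sum_minus:
  fixes f g :: "'a \<Rightarrow> complex"
  assumes "(f has_sum a) A" "(g has_sum b) A"
  shows "((\<lambda>x. f x - g x) has_sum (a - b)) A"
  using has_sum_add[OF assms(1), of "\<lambda>x. - g x" "- b"] assms(2) by (simp add: has_sum_uminus)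

lemma has_sum_telescoping_powr:
  assumes x: "0 < x" and s: "Re s > 1"
    and sm: "(\<lambda>n::nat. complex_of_real (real n + x) powr (1 - s) - complex_of_real (real n + x + 1) powr (1 - s))
               summable_on UNIV"
  shows "((\<lambda>n::nat. complex_of_real (real n + x) powr (1 - s) - complex_of_real (real n + x + 1) powr (1 - s))
           has_sum (complex_of_real x powr (1 - s))) UNIV"
proof -
  let ?d = "\<lambda>n::nat. complex_of_real (real n + x) powr (1 - s) - complex_of_real (real n + x + 1) powr (1 - s)"
  define f where "f = (\<lambda>n::nat. complex_of_real (real n + x) powr (1 - s))"
  have d: "?d = (\<lambda>n. f n - f (Suc n))" by (simp add: f_def add_ac)
  have "(\<lambda>n. (real n + x) powr (1 - Re s)) \<longlonglongrightarrow> 0"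
    using s by (intro tendsto_neg_powr filterlim_tendsto_add_at_top[OF tendsto_const filterlim_real_sequentially, of x, simplified add.commute[of x]]) auto
  then have "(\<lambda>n. norm (f n)) \<longlonglongrightarrow> 0"
    using x by (simp add: f_def norm_powr_real_powr del: of_real_add)
  then have "f \<longlonglongrightarrow> 0" by (simp add: tendsto_norm_zero_iff)
  then have "?d sums (f 0 - 0)" unfolding d by (rule telescope_sums')
  moreover have "?d sums (infsum ?d UNIV)" using sm by (intro has_sum_imp_sums has_sum_infsum)
  ultimately have eq: "infsum ?d UNIV = complex_of_real x powr (1 - s)"
    by (simp add: sums_unique2 f_def)
  from has_sum_infsum[OF sm] show ?thesis unfolding eq .
qed

text \<open>
  Sum \<open>taylor_tail_identity\<close> over \<open>y = m+a\<close>; the telescoping part collapses to \<open>a\<^sup>1\<^sup>-\<^sup>s\<close>.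
\<close>

lemma hurwitz_zeta_recursion:
  assumes a: "0 < a" "a \<le> 1" and K: "1 \<le> K" and s: "Re s > 1"
  shows "(s - 1) * hurwitz_zeta a s = complex_of_real a powr (1 - s) +
     (\<Sum>k=1..<K. ((1 - s) gchoose Suc k) * hurwitz_zeta a (s + of_nat k)) +
     (\<Sum>\<^sub>\<infinity>m. taylor_tail K s (real m + a))"
proof -
  let ?y = "\<lambda>m::nat. real m + a"
  let ?R = "\<Sum>\<^sub>\<infinity>m. taylor_tail K s (real m + a)"
  let ?S = "\<Sum>k=1..<K. ((1 - s) gchoose Suc k) * hurwitz_zeta a (s + of_nat k)"
  have 1: "((\<lambda>m. (s - 1) * complex_of_real (?y m) powr - s) has_sum ((s - 1) * hurwitz_zeta a s)) UNIV"
    by (intro has_sum_cmult_right hurwitz_zeta_has_sum a s)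
  have 2: "((\<lambda>m. \<Sum>k=1..<K. ((1 - s) gchoose Suc k) * complex_of_real (?y m) powr - (s + of_nat k)) has_sum ?S) UNIV"
    using s by (intro has_sum_finite_sum has_sum_cmult_right hurwitz_zeta_has_sum a) auto
  have 3: "((\<lambda>m. taylor_tail K s (?y m)) has_sum ?R) UNIV"
    by (intro has_sum_infsum decays_single_summable[OF a decays_taylor_tail[OF a(1)]]) (use s in simp)
  have "((\<lambda>m. (s - 1) * complex_of_real (?y m) powr - s -
      (\<Sum>k=1..<K. ((1 - s) gchoose Suc k) * complex_of_real (?y m) powr - (s + of_nat k)) -
      taylor_tail K s (?y m)) has_sum ((s - 1) * hurwitz_zeta a s - ?S - ?R)) UNIV"
    by (intro has_sum_minus 1 2 3)
  then have 4: "((\<lambda>m. complex_of_real (?y m) powr (1 - s) - complex_of_real (?y m + 1) powr (1 - s))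
      has_sum ((s - 1) * hurwitz_zeta a s - ?S - ?R)) UNIV"
    by (simp only: taylor_tail_identity[OF K] diff_diff_eq add.assoc add_diff_cancel_right')
  then have "(s - 1) * hurwitz_zeta a s - ?S - ?R = complex_of_real a powr (1 - s)"
    using has_sum_telescoping_powr[OF a(1) s has_sum_imp_summable] has_sum_unique by blast
  then show ?thesis by (simp only: diff_eq_eq add_ac)
qed

text \<open>
  The telescoping part of the sum over \<open>n\<close> collapses to \<open>x\<^sup>1\<^sup>-\<^sup>s\<^sup>2\<close> with \<open>x = m+a\<close>, and multiplied by the
  outer factor \<open>x\<^sup>-\<^sup>s\<^sup>1\<close> this is the general term of \<open>\<zeta>(s\<^sub>1+s\<^sub>2-1)\<close>.
\<close>

lemma zeta2_star_recursion:
  assumes a: "0 < a" "a \<le> 1" and K: "1 \<le> K" and s: "(s1, s2) \<in> zeta_region 0"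
  shows "(s2 - 1) * zeta2_star a (s1, s2) = hurwitz_zeta a (s1 + s2 - 1) +
     (\<Sum>k=1..<K. ((1 - s2) gchoose Suc k) * zeta2_star a (s1, s2 + of_nat k)) +
     (\<Sum>\<^sub>\<infinity>(m, n). complex_of_real (real m + a) powr - s1 * taylor_tail K s2 (real m + real n + a))"
proof -
  let ?x = "\<lambda>m::nat. complex_of_real (real m + a) powr - s1"
  let ?y = "\<lambda>(m::nat) (n::nat). real m + real n + a"
  let ?R = "\<Sum>\<^sub>\<infinity>(m, n). ?x m * taylor_tail K s2 (?y m n)"
  let ?S = "\<Sum>k=1..<K. ((1 - s2) gchoose Suc k) * zeta2_star a (s1, s2 + of_nat k)"
  let ?L = "(s2 - 1) * zeta2_star a (s1, s2) - ?S - ?R"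
  let ?d = "\<lambda>m n. complex_of_real (?y m n) powr (1 - s2) - complex_of_real (?y m n + 1) powr (1 - s2)"
  have s2: "Re s2 > 1" "Re (s1 + s2) > 2" using s by (auto simp: zeta_region_def)
  have sK: "(s1, s2) \<in> zeta_region K" "(s1, s2 + of_nat k) \<in> zeta_region 0" for k
    using s2 by (auto simp: zeta_region_def)
  have 1: "((\<lambda>mn. (s2 - 1) * (case mn of (m, n) \<Rightarrow> ?x m * complex_of_real (?y m n) powr - s2))
       has_sum ((s2 - 1) * zeta2_star a (s1, s2))) (UNIV \<times> UNIV)"
    by (intro has_sum_cmult_right zeta2_star_has_sum a s)
  have 2: "((\<lambda>mn. \<Sum>k=1..<K. ((1 - s2) gchoose Suc k) *
        (case mn of (m, n) \<Rightarrow> ?x m * complex_of_real (?y m n) powr - (s2 + of_nat k))) has_sum ?S) (UNIV \<times> UNIV)"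
    by (intro has_sum_finite_sum has_sum_cmult_right zeta2_star_has_sum a sK) auto
  have 3: "((\<lambda>(m, n). ?x m * taylor_tail K s2 (?y m n)) has_sum ?R) (UNIV \<times> UNIV)"
    using has_sum_infsum[OF decays_double_summable[OF a decays_taylor_tail[OF a(1)] sK(1)]] by simp
  have "((\<lambda>mn. (s2 - 1) * (case mn of (m, n) \<Rightarrow> ?x m * complex_of_real (?y m n) powr - s2) -
      (\<Sum>k=1..<K. ((1 - s2) gchoose Suc k) *
        (case mn of (m, n) \<Rightarrow> ?x m * complex_of_real (?y m n) powr - (s2 + of_nat k))) -
      (case mn of (m, n) \<Rightarrow> ?x m * taylor_tail K s2 (?y m n))) has_sum ?L) (UNIV \<times> UNIV)"
    by (intro has_sum_minus 1 2 3)
  also have "(\<lambda>mn. (s2 - 1) * (case mn of (m, n) \<Rightarrow> ?x m * complex_of_real (?y m n) powr - s2) -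
      (\<Sum>k=1..<K. ((1 - s2) gchoose Suc k) *
        (case mn of (m, n) \<Rightarrow> ?x m * complex_of_real (?y m n) powr - (s2 + of_nat k))) -
      (case mn of (m, n) \<Rightarrow> ?x m * taylor_tail K s2 (?y m n))) = (\<lambda>(m, n). ?x m * ?d m n)"
  proof (intro ext, clarify)
    fix m n
    have "(s2 - 1) * (?x m * complex_of_real (?y m n) powr - s2) =
        ?x m * ((s2 - 1) * complex_of_real (?y m n) powr - s2)" by simp
    also have "\<dots> = ?x m * (?d m n + (\<Sum>k=1..<K. ((1 - s2) gchoose Suc k) *
        complex_of_real (?y m n) powr - (s2 + of_nat k)) + taylor_tail K s2 (?y m n))"
      by (simp only: taylor_tail_identity[OF K])
    finally show "(s2 - 1) * (?x m * complex_of_real (?y m n) powr - s2) -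
      (\<Sum>k=1..<K. ((1 - s2) gchoose Suc k) * (?x m * complex_of_real (?y m n) powr - (s2 + of_nat k))) -
      ?x m * taylor_tail K s2 (?y m n) = ?x m * ?d m n"
      by (simp add: ring_distribs sum_distrib_left mult.left_commute)
  qed
  \<comment> \<open>All parts are absolutely summable over pairs, hence so is the telescoping part, and it
      may be summed row by row.\<close>
  finally have 4: "((\<lambda>(m, n). ?x m * ?d m n) has_sum ?L) (UNIV \<times> UNIV)" .
  have "((\<lambda>m. ?x m * complex_of_real (real m + a) powr (1 - s2)) has_sum ?L) UNIV"
  proof (rule has_sum_SigmaD[OF 4], simp only: prod.case)
    fix m
    have "(\<lambda>n. ?x m * ?d m n) summable_on UNIV"
      using summable_on_SigmaD1[OF has_sum_imp_summable[OF 4]] by blast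
    moreover have "?x m \<noteq> 0" using a by (simp add: powr_eq_0_iff del: of_real_add)
    ultimately have sd: "?d m summable_on UNIV" by (rule summable_on_cmult_right'[THEN iffD1, rotated])
    have yc: "?y m n = real n + (real m + a)" for n by simp
    have "0 < real m + a" using a by simp
    from has_sum_telescoping_powr[OF this s2(1) sd[unfolded yc]]
    have "(?d m has_sum complex_of_real (real m + a) powr (1 - s2)) UNIV" unfolding yc .
    then show "((\<lambda>n. ?x m * ?d m n) has_sum (?x m * complex_of_real (real m + a) powr (1 - s2))) UNIV"
      by (rule has_sum_cmult_right)
  qed
  moreover have "?x m * complex_of_real (real m + a) powr (1 - s2) = complex_of_real (real m + a) powr - (s1 + s2 - 1)" for m
    unfolding powr_add[symmetric] by (rule arg_cong[of _ _ "\<lambda>t. complex_of_real (real m + a) powr t"]) simp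
  moreover have "((\<lambda>m. complex_of_real (real m + a) powr - (s1 + s2 - 1)) has_sum hurwitz_zeta a (s1 + s2 - 1)) UNIV"
    using s2 by (intro hurwitz_zeta_has_sum a) auto
  ultimately have "?L = hurwitz_zeta a (s1 + s2 - 1)" by (simp add: has_sum_unique)
  then show ?thesis by (simp only: diff_eq_eq add_ac)
qed

text \<open>
  The pairs \<open>m \<le> k\<close> and \<open>k \<le> m\<close> contribute one star value each; the diagonal is then counted twice.
\<close>

lemma harmonic_product:
  assumes a: "0 < a" "a \<le> 1" and s: "Re s1 > 1" "Re s2 > 1"
  shows "hurwitz_zeta a s1 * hurwitz_zeta a s2 = zeta2_star a (s1, s2) + zeta2_star a (s2, s1) - hurwitz_zeta a (s1 + s2)"
proof -
  let ?x = "\<lambda>m::nat. complex_of_real (real m + a)"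
  define f where "f = (\<lambda>(m, k). ?x m powr - s1 * ?x k powr - s2)"
  have norm1: "(\<lambda>m. norm (?x m powr - s)) summable_on UNIV" if "Re s > 1" for s
    using hurwitz_zeta_has_sum[OF a that] by (metis has_sum_imp_summable summable_on_iff_abs_summable_on_complex)
  have "(\<lambda>p. norm (f p)) summable_on (UNIV \<times> UNIV)"
  proof (rule summable_on_SigmaI)
    show "((\<lambda>k. norm (f (m, k))) has_sum (norm (?x m powr - s1) * (\<Sum>\<^sub>\<infinity>k. norm (?x k powr - s2)))) UNIV" for m
      unfolding f_def prod.case norm_mult by (intro has_sum_cmult_right has_sum_infsum norm1 s)
    show "(\<lambda>m. norm (?x m powr - s1) * (\<Sum>\<^sub>\<infinity>k. norm (?x k powr - s2))) summable_on UNIV"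
      by (intro summable_on_cmult_left norm1 s)
  qed auto
  then have f: "f summable_on (UNIV \<times> UNIV)" by (rule abs_summable_summable)
  have fS: "f summable_on S" for S using f by (rule summable_on_subset_banach) auto
  have "((\<lambda>m. ?x m powr - s1 * hurwitz_zeta a s2) has_sum infsum f UNIV) UNIV"
  proof (rule has_sum_SigmaD[where B = "\<lambda>_. UNIV"])
    show "(f has_sum infsum f UNIV) (UNIV \<times> UNIV)" using has_sum_infsum[OF f] by simp
    show "((\<lambda>k. f (m, k)) has_sum (?x m powr - s1 * hurwitz_zeta a s2)) UNIV" for m
      unfolding f_def prod.case by (intro has_sum_cmult_right hurwitz_zeta_has_sum a s)
  qed
  moreover have "((\<lambda>m. ?x m powr - s1 * hurwitz_zeta a s2) has_sum (hurwitz_zeta a s1 * hurwitz_zeta a s2)) UNIV"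
    by (intro has_sum_cmult_left hurwitz_zeta_has_sum a s)
  ultimately have "hurwitz_zeta a s1 * hurwitz_zeta a s2 = infsum f UNIV" using has_sum_unique by blast
  also have "UNIV = {(m::nat, k). m \<le> k} \<union> {(m, k). k < m}" by auto
  also have "infsum f \<dots> = infsum f {(m, k). m \<le> k} + infsum f {(m, k). k < m}"
    by (rule infsum_Un_disjoint[OF fS fS]) auto
  also have "infsum f {(m, k). k < m} = infsum f {(m, k). k \<le> m} - infsum f {(m, k). m = k}"
  proof -
    have "{(m, k). k \<le> m} = {(m, k). k < m} \<union> {(m::nat, k). m = k}" by auto
    moreover have "infsum f ({(m, k). k < m} \<union> {(m::nat, k). m = k}) = infsum f {(m, k). k < m} + infsum f {(m, k). m = k}"
      by (rule infsum_Un_disjoint[OF fS fS]) auto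
    ultimately show ?thesis by simp
  qed
  also have "infsum f {(m, k). m = k} = hurwitz_zeta a (s1 + s2)"
    unfolding hurwitz_zeta_def
    by (rule infsum_reindex_bij_witness[of _ "\<lambda>m. (m, m)" fst])
       (auto simp: f_def simp flip: powr_add)
  also have "infsum f {(m, k). m \<le> k} = zeta2_star a (s1, s2)"
    unfolding zeta2_star_def
    by (rule infsum_reindex_bij_witness[of _ "\<lambda>(m, n). (m, m + n)" "\<lambda>(m, k). (m, k - m)"])
       (auto simp: f_def of_nat_diff)
  also have "infsum f {(m, k). k \<le> m} = zeta2_star a (s2, s1)"
    unfolding zeta2_star_def
    by (rule infsum_reindex_bij_witness[of _ "\<lambda>(m, n). (m + n, m)" "\<lambda>(m, k). (k, m - k)"])
       (auto simp: f_def of_nat_diff)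
  finally show ?thesis by simp
qed

section \<open>The region of absolute convergence\<close>

lemma zeta2_series_eq:
  assumes a: "0 < a" "a \<le> 1" and s: "(s1, s2) \<in> zeta_region 0"
  shows "zeta2_series a s1 s2 = zeta2_star a (s1, s2) - hurwitz_zeta a (s1 + s2)"
proof -
  let ?x = "\<lambda>m::nat. complex_of_real (real m + a)"
  let ?y = "\<lambda>m n. complex_of_real (real m + real n + a)"
  have s2: "Re s2 > 1" "Re (s1 + s2) > 1" using s by (auto simp: zeta_region_def)
  define I where "I = (\<lambda>m. \<Sum>\<^sub>\<infinity>n. ?y m n powr - s2)"
  have row: "((\<lambda>n. ?y m n powr - s2) has_sum I m) UNIV" for m
  proof -
    have "(\<lambda>n. ?x m powr - s1 * ?y m n powr - s2) summable_on UNIV"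
      using summable_on_SigmaD1[OF has_sum_imp_summable[OF zeta2_star_has_sum[OF a s]]] by blast
    moreover have "?x m powr - s1 \<noteq> 0" using a by (simp del: of_real_add)
    ultimately have "(\<lambda>n. ?y m n powr - s2) summable_on UNIV"
      by (rule summable_on_cmult_right'[THEN iffD1, rotated])
    then show ?thesis unfolding I_def by (rule has_sum_infsum)
  qed
  have inner: "(\<Sum>n. 1 / ?y m (Suc n) powr s2) = I m - ?x m powr - s2" for m
  proof -
    have "(\<lambda>n. ?y m (Suc n) powr - s2) sums (I m - ?y m 0 powr - s2)"
      using has_sum_imp_sums[OF row[of m]] by (subst sums_Suc_iff) simp
    then show ?thesis by (simp add: sums_iff powr_minus_divide)
  qed
  have "((\<lambda>m. ?x m powr - s1 * I m) has_sum zeta2_star a (s1, s2)) UNIV"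
  proof (rule has_sum_SigmaD[OF zeta2_star_has_sum[OF a s]], simp only: prod.case)
    show "((\<lambda>n. ?x m powr - s1 * ?y m n powr - s2) has_sum (?x m powr - s1 * I m)) UNIV" for m
      by (intro has_sum_cmult_right row)
  qed
  from has_sum_minus[OF this hurwitz_zeta_has_sum[OF a s2(2)]]
  have "(\<lambda>m. ?x m powr - s1 * I m - ?x m powr - (s1 + s2)) sums (zeta2_star a (s1, s2) - hurwitz_zeta a (s1 + s2))"
    by (rule has_sum_imp_sums)
  moreover have "?x m powr - s1 * I m - ?x m powr - (s1 + s2) =
      1 / ?x m powr s1 * (\<Sum>n. 1 / ?y m (Suc n) powr s2)" for m
  proof -
    have "?x m powr - (s1 + s2) = ?x m powr - s1 * ?x m powr - s2"
      unfolding powr_add[symmetric] by simp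
    then show ?thesis unfolding inner by (simp add: right_diff_distrib powr_minus_divide)
  qed
  ultimately show ?thesis unfolding zeta2_series_def by (simp only: sums_iff)
qed

lemma not_summable_on_harmonic:
  fixes g :: "nat \<Rightarrow> real"
  assumes c: "c > 0" and g: "\<And>n. n \<ge> 1 \<Longrightarrow> c / real (n + 1) \<le> g n"
  shows "\<not> g summable_on UNIV"
proof
  assume "g summable_on UNIV"
  then have "summable g" by (rule summable_on_imp_summable)
  then have "summable (\<lambda>n. c / real (n + 1))"
    by (rule summable_comparison_test'[where N = 1]) (use c g in auto)
  then have "summable (\<lambda>n. inverse c * (c / real (n + 1)))" by (rule summable_mult)
  then have "summable (\<lambda>n. real (n + 1) powr - 1)"
    using c by (simp add: field_simps powr_minus)
  then have "summable (\<lambda>n. real n powr - 1)" by (subst (asm) summable_iff_shift)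
  then show False by (subst (asm) summable_real_powr_iff) simp
qed

text \<open>
  That the series does not converge absolutely outside the region matters as much as the converse,
  since a continuation has to be holomorphic at all points of absolute convergence. The row \<open>m = 0\<close>
  forces \<open>Re s2 > 1\<close>. The triangle \<open>n \<le> m\<close> forces \<open>Re (s1 + s2) > 2\<close>: there \<open>m+n+1+a\<close> is comparable to
  \<open>x = m+a\<close>, so the \<open>m+1\<close> terms of a row add up to at least a constant times
  \<open>x powr (1 - Re s1 - Re s2)\<close>.
\<close>

lemma zeta2_abs_conv_eq:
  assumes a: "0 < a" "a \<le> 1"
  shows "zeta2_abs_conv a = zeta_region 0"
proof (intro equalityI subsetI)
  fix p assume p: "p \<in> zeta_region 0"
  obtain s1 s2 where ps: "p = (s1, s2)" by (cases p)
  let ?f = "\<lambda>(m::nat, n::nat). complex_of_real (real m + a) powr - s1 * complex_of_real (real m + real n + a) powr - s2"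
  let ?g = "\<lambda>(m::nat, n::nat). (m, Suc n)"
  have "?f summable_on UNIV"
    using has_sum_imp_summable[OF zeta2_star_has_sum[OF a p[unfolded ps]]] by simp
  then have "(\<lambda>mn. norm (?f mn)) summable_on UNIV" by (simp only: summable_on_iff_abs_summable_on_complex)
  then have "(\<lambda>mn. norm (?f mn)) summable_on range ?g" by (rule summable_on_subset_banach) simp
  then have "((\<lambda>mn. norm (?f mn)) \<circ> ?g) summable_on UNIV"
    by (subst summable_on_reindex[symmetric]) (auto simp: inj_on_def)
  then show "p \<in> zeta2_abs_conv a"
    unfolding ps zeta2_abs_conv_def by (simp add: o_def case_prod_unfold powr_minus_divide norm_mult norm_divide)
next
  fix p assume p: "p \<in> zeta2_abs_conv a"
  obtain s1 s2 where ps: "p = (s1, s2)" by (cases p)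
  let ?q = "\<lambda>m n. (real m + a) powr - Re s1 * (real m + real (Suc n) + a) powr - Re s2"
  have "norm (1 / complex_of_real (real m + a) powr s1 * (1 / complex_of_real (real m + real (Suc n) + a) powr s2)) = ?q m n"
    for m n :: nat
  proof -
    have "0 < real m + a" "0 < real m + real (Suc n) + a" using a by auto
    then show ?thesis by (simp only: norm_mult norm_divide norm_one norm_powr_real_powr powr_minus_divide
      norm_of_real complex_is_Real_iff Im_complex_of_real Re_complex_of_real abs_of_pos)
  qed
  then have q: "(\<lambda>(m, n). ?q m n) summable_on (UNIV \<times> UNIV)"
    using p unfolding ps zeta2_abs_conv_def by (simp only: mem_Collect_eq prod.case UNIV_Times_UNIV)
  have 2: "Re s2 > 1"
  proof (rule ccontr)
    assume le: "\<not> Re s2 > 1"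
    have "(\<lambda>n. ?q 0 n) summable_on UNIV"
      using summable_on_SigmaD1[OF q, of 0] by simp
    moreover have "\<not> (\<lambda>n. ?q 0 n) summable_on UNIV"
    proof (rule not_summable_on_harmonic)
      show "a powr - Re s1 / 2 > 0" using a by simp
      fix n :: nat
      have "1 / (2 * real (n + 1)) \<le> 1 / (real (Suc n) + a)"
        using a by (intro divide_left_mono) auto
      also have "1 / (real (Suc n) + a) = (real (Suc n) + a) powr - 1" using a by (simp add: powr_minus_divide)
      also have "\<dots> \<le> (real (Suc n) + a) powr - Re s2" using le a by (intro powr_mono) auto
      finally have "a powr - Re s1 * (1 / (2 * real (n + 1))) \<le> a powr - Re s1 * (real (Suc n) + a) powr - Re s2"
        by (intro mult_left_mono) auto
      then show "a powr - Re s1 / 2 / real (n + 1) \<le> ?q 0 n" by simp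
    qed
    ultimately show False by contradiction
  qed
  have "Re (s1 + s2) > 2"
  proof (rule ccontr)
    assume le: "\<not> Re (s1 + s2) > 2"
    have "(\<lambda>(m, n). ?q m n) summable_on (Sigma UNIV (\<lambda>m. {..m}))"
      using q by (rule summable_on_subset_banach) auto
    from summable_on_Sigma_banach[OF this]
    have "(\<lambda>m. \<Sum>n\<le>m. ?q m n) summable_on UNIV" by simp
    moreover have "\<not> (\<lambda>m. \<Sum>n\<le>m. ?q m n) summable_on UNIV"
    proof (rule not_summable_on_harmonic)
      show "3 powr - Re s2 > (0::real)" by simp
      fix m :: nat assume m: "m \<ge> 1"
      define x where "x = real m + a"
      have x: "1 \<le> x" "x \<le> real m + 1" using m a by (auto simp: x_def)
      have "3 powr - Re s2 / real (m + 1) \<le> 3 powr - Re s2 * x powr - 1"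
        using x by (simp add: powr_minus_divide divide_left_mono)
      also have "x powr - 1 \<le> x powr (1 - Re s1 - Re s2)" using x le by (intro powr_mono) auto
      also have "3 powr - Re s2 * x powr (1 - Re s1 - Re s2) = x * (x powr - Re s1 * (3 * x) powr - Re s2)"
      proof -
        have "x powr (1 - Re s1 - Re s2) = x powr (1 + (- Re s1) + (- Re s2))" by simp
        also have "\<dots> = x * x powr - Re s1 * x powr - Re s2" using x by (simp only: powr_add powr_one)
        finally show ?thesis using x by (simp add: powr_mult)
      qed
      also have "\<dots> \<le> (real m + 1) * (x powr - Re s1 * (3 * x) powr - Re s2)"
        using x by (intro mult_right_mono) auto
      also have "\<dots> = (\<Sum>n\<le>m. x powr - Re s1 * (3 * x) powr - Re s2)" by simp
      also have "\<dots> \<le> (\<Sum>n\<le>m. ?q m n)"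
      proof (rule sum_mono)
        fix n assume "n \<in> {..m}"
        then have "real m + real (Suc n) + a \<le> 3 * x" using m a by (simp add: x_def)
        then show "x powr - Re s1 * (3 * x) powr - Re s2 \<le> ?q m n"
          using 2 a unfolding x_def by (intro mult_left_mono powr_mono2') auto
      qed
      finally show "3 powr - Re s2 / real (m + 1) \<le> (\<Sum>n\<le>m. ?q m n)"
        by (simp add: mult_left_mono)
    qed
    ultimately show False by contradiction
  qed
  with 2 show "p \<in> zeta_region 0" by (simp add: ps zeta_region_def)
qed

section \<open>Existence of the meromorphic continuation\<close>

text \<open>
  The complement of the hyperplanes \<open>s\<^sub>2 = 1, 0, -1, \<dots>\<close> and \<open>s\<^sub>1 + s\<^sub>2 = 2, 1, 0, \<dots>\<close>, the only places
  where the iterated recursions divide by zero. It is stable under \<open>s\<^sub>2 \<mapsto> s\<^sub>2 + k\<close>, and it contains the points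
  \<open>(\<sigma>, \<sigma>)\<close> with \<open>1/2 < \<sigma> < 1\<close>.
\<close>

definition regular_points :: "(complex \<times> complex) set" where
  "regular_points = {p. snd p - 1 \<notin> \<int>\<^sub>\<le>\<^sub>0 \<and> fst p + snd p - 2 \<notin> \<int>\<^sub>\<le>\<^sub>0}"

lemma nonpos_Ints_complexD:
  assumes "z \<in> (\<int>\<^sub>\<le>\<^sub>0 :: complex set)" shows "Re z \<le> 0" "Im z = 0"
  using assms by (auto elim!: nonpos_Ints_cases)

lemma open_regular_points: "open regular_points"
proof -
  have "regular_points = (\<lambda>p. snd p - 1) -` (- \<int>\<^sub>\<le>\<^sub>0) \<inter> (\<lambda>p. fst p + snd p - 2) -` (- \<int>\<^sub>\<le>\<^sub>0)"
    by (auto simp: regular_points_def)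
  also have "open \<dots>"
    by (intro open_Int open_vimage open_Compl closed_nonpos_Ints continuous_intros)
  finally show ?thesis .
qed

lemma closure_regular_points: "closure regular_points = UNIV"
proof -
  have "p \<in> closure regular_points" for p
  \<comment> \<open>On the excluded hyperplanes \<open>s2\<close> or \<open>s1 + s2\<close> is real; a small imaginary shift of \<open>s2\<close> avoids both.\<close>
  proof (subst closure_approachable, intro allI impI)
    fix e :: real assume e: "e > 0"
    let ?bad = "{- Im (snd p), - Im (fst p + snd p)}"
    have "infinite {0<..<e}" using e by simp
    then have "\<not> {0<..<e} \<subseteq> ?bad" using finite_subset by blast
    then obtain t where t: "0 < t" "t < e" "t \<notin> ?bad"
      by (meson greaterThanLessThan_iff subsetI)
    define q where "q = (fst p, snd p + \<i> * of_real t)"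
    have "Im (snd q - 1) \<noteq> 0" "Im (fst q + snd q - 2) \<noteq> 0" using t by (auto simp: q_def)
    then have "q \<in> regular_points"
      unfolding regular_points_def using nonpos_Ints_complexD(2) by blast
    moreover have "dist q p < e"
      using t by (cases p) (simp add: q_def dist_Pair_Pair dist_norm norm_mult)
    ultimately show "\<exists>y\<in>regular_points. dist y p < e" by blast
  qed
  then show ?thesis by blast
qed

lemma zeta_region_subset_regular: "zeta_region 0 \<subseteq> regular_points"
  unfolding zeta_region_def regular_points_def using nonpos_Ints_complexD(1) by fastforce

lemma zeta_region_antimono: "M \<le> N \<Longrightarrow> zeta_region M \<subseteq> zeta_region N"
  by (auto simp: zeta_region_def)

lemma zeta_region_exhausts: "\<exists>N. p \<in> zeta_region N"
proof -
  obtain N :: nat where "max (1 - Re (snd p)) (2 - Re (fst p + snd p)) < real N"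
    using reals_Archimedean2 by blast
  then show ?thesis by (intro exI[of _ N]) (auto simp: zeta_region_def)
qed

lemma zeta_region_shift:
  assumes "p \<in> zeta_region (Suc N)" "1 \<le> k"
  shows "(fst p, snd p + of_nat k) \<in> zeta_region N"
proof -
  have "real k \<ge> 1" using assms(2) by simp
  then show ?thesis using assms(1) by (auto simp: zeta_region_def)
qed

lemma regular_points_shift:
  assumes "p \<in> regular_points"
  shows "(fst p, snd p + of_nat k) \<in> regular_points"
proof -
  have *: "z \<in> \<int>\<^sub>\<le>\<^sub>0" if "z + of_nat k \<in> \<int>\<^sub>\<le>\<^sub>0" for z :: complex
  proof -
    have "z = (z + of_nat k) - of_nat k" by simp
    then show ?thesis using that by (metis nonpos_Ints_diff_Nats of_nat_in_Nats)
  qed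
  show ?thesis using assms *[of "snd p - 1"] *[of "fst p + snd p - 2"]
    by (auto simp: regular_points_def algebra_simps)
qed

lemma zeta_region_0_open_nonempty:
  "open (zeta_region 0)" "zeta_region 0 \<noteq> {}"
proof -
  have "(2, 2) \<in> zeta_region 0" by (simp add: zeta_region_def)
  then show "zeta_region 0 \<noteq> {}" by blast
qed (rule open_zeta_region)

lemma connected_zeta_region: "connected (zeta_region N)"
  by (rule convex_connected[OF convex_zeta_region])

text \<open>
  \<open>F\<close> extends from the region of absolute convergence to \<open>zeta_region N\<close> as a quotient \<open>g / h\<close> whose
  denominator vanishes only outside the regular points. Only the values of \<open>F\<close> on
  \<open>zeta_region 0\<close> enter, so the defining series may be inserted for \<open>F\<close> directly, and the closure
  properties below reduce to computations where everything converges.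
\<close>

definition continuable :: "nat \<Rightarrow> (complex \<times> complex \<Rightarrow> complex) \<Rightarrow> bool" where
  "continuable N F \<longleftrightarrow> (\<exists>g h. holomorphic2_on g (zeta_region N) \<and> holomorphic2_on h (zeta_region N) \<and>
     (\<forall>p\<in>zeta_region N \<inter> regular_points. h p \<noteq> 0) \<and> (\<forall>p\<in>zeta_region 0. g p = h p * F p))"

lemma continuableE:
  assumes "continuable N F"
  obtains g h where "holomorphic2_on g (zeta_region N)" "holomorphic2_on h (zeta_region N)"
    "\<And>p. p \<in> zeta_region N \<Longrightarrow> p \<in> regular_points \<Longrightarrow> h p \<noteq> 0"
    "\<And>p. p \<in> zeta_region 0 \<Longrightarrow> g p = h p * F p"
  using assms unfolding continuable_def by blast

lemma continuable_antimono:
  assumes "continuable M F" "N \<le> M" shows "continuable N F"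
proof -
  obtain g h where 1: "holomorphic2_on g (zeta_region M)" "holomorphic2_on h (zeta_region M)"
    "\<And>p. p \<in> zeta_region M \<Longrightarrow> p \<in> regular_points \<Longrightarrow> h p \<noteq> 0"
    "\<And>p. p \<in> zeta_region 0 \<Longrightarrow> g p = h p * F p" by (rule continuableE[OF assms(1)]) blast
  have sub: "zeta_region N \<subseteq> zeta_region M" by (rule zeta_region_antimono[OF assms(2)])
  show ?thesis unfolding continuable_def
    by (rule exI[of _ g], rule exI[of _ h])
       (use 1 sub holomorphic2_on_subset[OF _ open_zeta_region sub] in auto)
qed

lemma continuable_holomorphic:
  assumes "holomorphic2_on F (zeta_region N)" shows "continuable N F"
  unfolding continuable_def
  using assms by (intro exI[of _ F] exI[of _ "\<lambda>_. 1"]) (auto simp: holomorphic2_on_const open_zeta_region)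

lemma continuable_add:
  assumes "continuable N F" "continuable N G" shows "continuable N (\<lambda>p. F p + G p)"
proof -
  obtain g1 h1 where 1: "holomorphic2_on g1 (zeta_region N)" "holomorphic2_on h1 (zeta_region N)"
    "\<And>p. p \<in> zeta_region N \<Longrightarrow> p \<in> regular_points \<Longrightarrow> h1 p \<noteq> 0"
    "\<And>p. p \<in> zeta_region 0 \<Longrightarrow> g1 p = h1 p * F p" by (rule continuableE[OF assms(1)]) blast
  obtain g2 h2 where 2: "holomorphic2_on g2 (zeta_region N)" "holomorphic2_on h2 (zeta_region N)"
    "\<And>p. p \<in> zeta_region N \<Longrightarrow> p \<in> regular_points \<Longrightarrow> h2 p \<noteq> 0"
    "\<And>p. p \<in> zeta_region 0 \<Longrightarrow> g2 p = h2 p * G p" by (rule continuableE[OF assms(2)]) blast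
  show ?thesis unfolding continuable_def
    by (rule exI[of _ "\<lambda>p. g1 p * h2 p + g2 p * h1 p"], rule exI[of _ "\<lambda>p. h1 p * h2 p"])
       (use 1 2 in \<open>auto intro!: holomorphic2_on_add holomorphic2_on_mult simp: algebra_simps\<close>)
qed

lemma continuable_mult:
  assumes "continuable N F" "holomorphic2_on c (zeta_region N)" shows "continuable N (\<lambda>p. c p * F p)"
proof -
  obtain g h where 1: "holomorphic2_on g (zeta_region N)" "holomorphic2_on h (zeta_region N)"
    "\<And>p. p \<in> zeta_region N \<Longrightarrow> p \<in> regular_points \<Longrightarrow> h p \<noteq> 0"
    "\<And>p. p \<in> zeta_region 0 \<Longrightarrow> g p = h p * F p" by (rule continuableE[OF assms(1)]) blast
  show ?thesis unfolding continuable_def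
    by (rule exI[of _ "\<lambda>p. c p * g p"], rule exI[of _ h])
       (use 1 assms(2) in \<open>auto intro!: holomorphic2_on_mult simp: algebra_simps\<close>)
qed

lemma continuable_quotient:
  assumes "continuable N G" and l: "holomorphic2_on l (zeta_region N)"
    "\<And>p. p \<in> zeta_region N \<Longrightarrow> p \<in> regular_points \<Longrightarrow> l p \<noteq> 0"
    and G: "\<And>p. p \<in> zeta_region 0 \<Longrightarrow> l p * F p = G p"
  shows "continuable N F"
proof -
  obtain g h where 1: "holomorphic2_on g (zeta_region N)" "holomorphic2_on h (zeta_region N)"
    "\<And>p. p \<in> zeta_region N \<Longrightarrow> p \<in> regular_points \<Longrightarrow> h p \<noteq> 0"
    "\<And>p. p \<in> zeta_region 0 \<Longrightarrow> g p = h p * G p" by (rule continuableE[OF assms(1)]) blast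
  show ?thesis unfolding continuable_def
  proof (rule exI[of _ g], rule exI[of _ "\<lambda>p. h p * l p"], intro conjI ballI)
    show "g p = h p * l p * F p" if "p \<in> zeta_region 0" for p
      using 1(4)[OF that] G[OF that] by simp
  qed (use 1 l in \<open>auto intro!: holomorphic2_on_mult\<close>)
qed

lemma continuable_sum:
  assumes "finite A" "\<And>k. k \<in> A \<Longrightarrow> continuable N (F k)"
  shows "continuable N (\<lambda>p. \<Sum>k\<in>A. F k p)"
  using assms
  by (induction rule: finite_induct)
     (auto intro: continuable_add continuable_holomorphic holomorphic2_on_const open_zeta_region)

lemma continuable_shift:
  assumes "continuable N F" "1 \<le> k"
  shows "continuable (Suc N) (\<lambda>p. F (fst p, snd p + of_nat k))"
proof -
  obtain g h where 1: "holomorphic2_on g (zeta_region N)" "holomorphic2_on h (zeta_region N)"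
    "\<And>p. p \<in> zeta_region N \<Longrightarrow> p \<in> regular_points \<Longrightarrow> h p \<noteq> 0"
    "\<And>p. p \<in> zeta_region 0 \<Longrightarrow> g p = h p * F p" by (rule continuableE[OF assms(1)]) blast
  have sub: "zeta_region (Suc N) \<subseteq> {p. (fst p, snd p + of_nat k) \<in> zeta_region N}"
    using zeta_region_shift assms(2) by blast
  have sh: "holomorphic2_on (\<lambda>p. f (fst p, snd p + of_nat k)) (zeta_region (Suc N))"
    if "holomorphic2_on f (zeta_region N)" for f
    by (rule holomorphic2_on_subset[OF holomorphic2_on_shift_snd[OF that] open_zeta_region sub])
  show ?thesis unfolding continuable_def
  proof (intro exI conjI ballI)
    show "holomorphic2_on (\<lambda>p. g (fst p, snd p + of_nat k)) (zeta_region (Suc N))"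
         "holomorphic2_on (\<lambda>p. h (fst p, snd p + of_nat k)) (zeta_region (Suc N))"
      using sh 1 by blast+
    show "h (fst p, snd p + of_nat k) \<noteq> 0" if "p \<in> zeta_region (Suc N) \<inter> regular_points" for p
      using 1(3)[of "(fst p, snd p + of_nat k)"] regular_points_shift[of p k]
        zeta_region_shift[OF _ assms(2), of p N] that by auto
    show "g (fst p, snd p + of_nat k) = h (fst p, snd p + of_nat k) * F (fst p, snd p + of_nat k)"
      if "p \<in> zeta_region 0" for p
      by (rule 1(4)) (use that in \<open>auto simp: zeta_region_def\<close>)
  qed
qed

text \<open>
  In the step from \<open>N\<close> to \<open>N + 1\<close> the recursion is used with \<open>K = N + 1\<close>: the shifts by \<open>k \<ge> 1\<close> need \<open>F\<close>
  only on \<open>zeta_region N\<close>, and the remainder is holomorphic on \<open>zeta_region (N + 1)\<close>.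
\<close>

lemma continuable_by_recursion:
  assumes base: "holomorphic2_on F (zeta_region 0)"
    and l: "holomorphic2_on l UNIV" "\<And>p. p \<in> regular_points \<Longrightarrow> l p \<noteq> 0"
    and F0: "\<And>N. continuable N F0"
    and b: "\<And>k. holomorphic2_on (b k) UNIV"
    and R: "\<And>K. 1 \<le> K \<Longrightarrow> holomorphic2_on (R K) (zeta_region K)"
    and rec: "\<And>K p. 1 \<le> K \<Longrightarrow> p \<in> zeta_region 0 \<Longrightarrow>
      l p * F p = F0 p + (\<Sum>k=1..<K. b k p * F (fst p, snd p + of_nat k)) + R K p"
  shows "continuable N F"
proof (induction N)
  case 0
  show ?case using base by (rule continuable_holomorphic)
next
  case (Suc N)
  have hol: "holomorphic2_on f (zeta_region (Suc N))" if "holomorphic2_on f UNIV" for f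
    using that open_zeta_region by (rule holomorphic2_on_subset) simp
  have "continuable (Suc N) (\<lambda>p. F0 p + (\<Sum>k=1..<Suc N. b k p * F (fst p, snd p + of_nat k)) + R (Suc N) p)"
    by (intro continuable_add F0 continuable_sum continuable_mult continuable_shift Suc hol b
          continuable_holomorphic R) auto
  then show ?case
  proof (rule continuable_quotient[OF _ hol[OF l(1)]])
    show "l p * F p = F0 p + (\<Sum>k=1..<Suc N. b k p * F (fst p, snd p + of_nat k)) + R (Suc N) p"
      if "p \<in> zeta_region 0" for p
      using that by (intro rec) auto
  qed (rule l(2))
qed

lemma hurwitz_zeta_holomorphic:
  assumes a: "0 < a" "a \<le> 1"
  shows "hurwitz_zeta a holomorphic_on {s. Re s > 1}"
  using decays_single_holomorphic[OF a decays_powr[OF a(1)]] by (simp add: hurwitz_zeta_def[abs_def])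

lemma hurwitz_zeta_diagonal_holomorphic:
  assumes a: "0 < a" "a \<le> 1"
  shows "holomorphic2_on (\<lambda>p. hurwitz_zeta a (fst p + snd p - 1)) (zeta_region 0)"
  using holomorphic2_on_compose_affine[OF hurwitz_zeta_holomorphic[OF a] open_zeta_region, of 0 1 1 "-1"]
  by (simp add: zeta_region_def)

lemma continuable_hurwitz_zeta:
  assumes a: "0 < a" "a \<le> 1"
  shows "continuable N (\<lambda>p. hurwitz_zeta a (fst p + snd p - 1))"
proof (rule continuable_by_recursion[where l = "\<lambda>p. fst p + snd p - 2"
    and ?F0.0 = "\<lambda>p. complex_of_real a powr (1 - (fst p + snd p - 1))"
    and b = "\<lambda>k p. (1 - (fst p + snd p - 1)) gchoose Suc k"
    and R = "\<lambda>K p. \<Sum>\<^sub>\<infinity>m. taylor_tail K (fst p + snd p - 1) (real m + a)"])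
  have aff: "holomorphic2_on (\<lambda>p. f (fst p + snd p - 1)) U"
    if "f holomorphic_on S" "open U" "\<And>z w. (z, w) \<in> U \<Longrightarrow> z + w - 1 \<in> S" for f S U
    using holomorphic2_on_compose_affine[OF that(1,2), of 1 1 "-1"] that(3) by simp
  show "holomorphic2_on (\<lambda>p. hurwitz_zeta a (fst p + snd p - 1)) (zeta_region 0)"
    by (rule hurwitz_zeta_diagonal_holomorphic[OF a])
  show "holomorphic2_on (\<lambda>p. fst p + snd p - 2) UNIV"
    using aff[of "\<lambda>s. s - 1" UNIV UNIV] by (simp add: holomorphic_intros algebra_simps)
  show "fst p + snd p - 2 \<noteq> 0" if "p \<in> regular_points" for p
    using that by (auto simp: regular_points_def)
  have "(\<lambda>s. complex_of_real a powr (1 - s)) holomorphic_on UNIV"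
    using a by (auto intro!: holomorphic_intros)
  then show "continuable N (\<lambda>p. complex_of_real a powr (1 - (fst p + snd p - 1)))" for N
    by (intro continuable_holomorphic aff[of _ UNIV] open_zeta_region) auto
  show "holomorphic2_on (\<lambda>p. (1 - (fst p + snd p - 1)) gchoose Suc k) UNIV" for k
    by (intro aff[of _ UNIV] gchoose_holomorphic) auto
  show "holomorphic2_on (\<lambda>p. \<Sum>\<^sub>\<infinity>m. taylor_tail K (fst p + snd p - 1) (real m + a)) (zeta_region K)" for K
    by (rule aff[OF decays_single_holomorphic[OF a decays_taylor_tail[OF a(1)]] open_zeta_region])
       (auto simp: zeta_region_def)
  show "(fst p + snd p - 2) * hurwitz_zeta a (fst p + snd p - 1) =
         complex_of_real a powr (1 - (fst p + snd p - 1)) +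
         (\<Sum>k = 1..<K. ((1 - (fst p + snd p - 1)) gchoose Suc k) *
            hurwitz_zeta a (fst (fst p, snd p + of_nat k) + snd (fst p, snd p + of_nat k) - 1)) +
         (\<Sum>\<^sub>\<infinity>m. taylor_tail K (fst p + snd p - 1) (real m + a))"
    if "1 \<le> K" "p \<in> zeta_region 0" for K p
  proof -
    have s: "Re (fst p + snd p - 1) > 1" using that by (auto simp: zeta_region_def)
    have "fst p + snd p - 2 = fst p + snd p - 1 - 1" by simp
    moreover have "fst (fst p, snd p + of_nat k) + snd (fst p, snd p + of_nat k) - 1 = fst p + snd p - 1 + of_nat k" for k
      by simp
    ultimately show ?thesis using hurwitz_zeta_recursion[OF a that(1) s] by (simp only:)
  qed
qed

lemma continuable_zeta2_star:
  assumes a: "0 < a" "a \<le> 1"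
  shows "continuable N (zeta2_star a)"
proof (rule continuable_by_recursion[where l = "\<lambda>p. snd p - 1"
    and ?F0.0 = "\<lambda>p. hurwitz_zeta a (fst p + snd p - 1)"
    and b = "\<lambda>k p. (1 - snd p) gchoose Suc k"
    and R = "\<lambda>K p. \<Sum>\<^sub>\<infinity>(m, n). complex_of_real (real m + a) powr - fst p *
                     taylor_tail K (snd p) (real m + real n + a)"])
  have aff: "holomorphic2_on (\<lambda>p. f (snd p)) UNIV" if "f holomorphic_on UNIV" for f
    using holomorphic2_on_compose_affine[OF that open_UNIV, of 0 1 0] by simp
  show "holomorphic2_on (zeta2_star a) (zeta_region 0)"
    using decays_double_holomorphic[OF a decays_powr[OF a(1)]] by (simp only: zeta2_star_def[abs_def])
  show "holomorphic2_on (\<lambda>p. snd p - 1) UNIV" by (rule aff[of "\<lambda>s. s - 1"]) (intro holomorphic_intros)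
  show "snd p - 1 \<noteq> 0" if "p \<in> regular_points" for p
    using that by (auto simp: regular_points_def)
  show "continuable N (\<lambda>p. hurwitz_zeta a (fst p + snd p - 1))" for N by (rule continuable_hurwitz_zeta[OF a])
  show "holomorphic2_on (\<lambda>p. (1 - snd p) gchoose Suc k) UNIV" for k
    by (intro aff gchoose_holomorphic)
  show "holomorphic2_on (\<lambda>p. \<Sum>\<^sub>\<infinity>(m, n). complex_of_real (real m + a) powr - fst p *
                     taylor_tail K (snd p) (real m + real n + a)) (zeta_region K)" for K
    by (rule decays_double_holomorphic[OF a decays_taylor_tail[OF a(1)]])
  show "(snd p - 1) * zeta2_star a p = hurwitz_zeta a (fst p + snd p - 1) +
         (\<Sum>k = 1..<K. ((1 - snd p) gchoose Suc k) * zeta2_star a (fst p, snd p + of_nat k)) +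
         (\<Sum>\<^sub>\<infinity>(m, n). complex_of_real (real m + a) powr - fst p *
                     taylor_tail K (snd p) (real m + real n + a))"
    if "1 \<le> K" "p \<in> zeta_region 0" for K p
    using zeta2_star_recursion[OF a that(1), of "fst p" "snd p"] that(2) by simp
qed

lemma continuable_zeta2:
  assumes a: "0 < a" "a \<le> 1"
  shows "continuable N (\<lambda>p. zeta2_star a p - hurwitz_zeta a (fst p + snd p))"
proof -
  \<comment> \<open>Shifting \<open>s2\<close> by \<open>1\<close> turns \<open>s1 + s2 - 1\<close> into \<open>s1 + s2\<close>.\<close>
  have "continuable (Suc N) (\<lambda>p. (-1) * hurwitz_zeta a (fst p + snd p))"
  proof (rule continuable_mult[OF _ holomorphic2_on_const[OF open_zeta_region]])
    show "continuable (Suc N) (\<lambda>p. hurwitz_zeta a (fst p + snd p))"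
      using continuable_shift[OF continuable_hurwitz_zeta[OF a, of N], of 1] by (simp add: add.assoc)
  qed
  from continuable_add[OF continuable_zeta2_star[OF a] this]
  have "continuable (Suc N) (\<lambda>p. zeta2_star a p - hurwitz_zeta a (fst p + snd p))" by simp
  then show ?thesis by (rule continuable_antimono) simp
qed

text \<open>
  The quotients \<open>g\<^sub>N / h\<^sub>N\<close> on the growing regions fit together: \<open>g\<^sub>M h\<^sub>N = g\<^sub>N h\<^sub>M\<close> holds on the region of
  absolute convergence, hence on the smaller of the two regions by the identity theorem.
\<close>

lemma continuable_imp_meromorphic2:
  assumes F: "\<And>N. continuable N F"
  obtains f where "meromorphic2 f regular_points" "\<And>p. p \<in> zeta_region 0 \<Longrightarrow> f p = F p"
    "\<And>N. \<exists>g h. holomorphic2_on g (zeta_region N) \<and> holomorphic2_on h (zeta_region N) \<and>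
       (\<forall>p\<in>zeta_region N \<inter> regular_points. h p \<noteq> 0 \<and> f p * h p = g p)"
proof -
  obtain g h where gh: "\<And>N. holomorphic2_on (g N) (zeta_region N)" "\<And>N. holomorphic2_on (h N) (zeta_region N)"
    "\<And>N p. p \<in> zeta_region N \<Longrightarrow> p \<in> regular_points \<Longrightarrow> h N p \<noteq> 0"
    "\<And>N p. p \<in> zeta_region 0 \<Longrightarrow> g N p = h N p * F p"
  proof -
    have "\<forall>N. \<exists>g h. holomorphic2_on g (zeta_region N) \<and> holomorphic2_on h (zeta_region N) \<and>
     (\<forall>p\<in>zeta_region N \<inter> regular_points. h p \<noteq> 0) \<and> (\<forall>p\<in>zeta_region 0. g p = h p * F p)"
      using F unfolding continuable_def by blast
    then obtain g where "\<forall>N. \<exists>h. holomorphic2_on (g N) (zeta_region N) \<and> holomorphic2_on h (zeta_region N) \<and>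
     (\<forall>p\<in>zeta_region N \<inter> regular_points. h p \<noteq> 0) \<and> (\<forall>p\<in>zeta_region 0. g N p = h p * F p)"
      by (rule choice[THEN exE])
    then obtain h where "\<forall>N. holomorphic2_on (g N) (zeta_region N) \<and> holomorphic2_on (h N) (zeta_region N) \<and>
     (\<forall>p\<in>zeta_region N \<inter> regular_points. h N p \<noteq> 0) \<and> (\<forall>p\<in>zeta_region 0. g N p = h N p * F p)"
      by (rule choice[THEN exE])
    then show thesis by (intro that[of g h]) auto
  qed
  have cross: "g M p * h N p = g N p * h M p" if p: "p \<in> zeta_region M" "M \<le> N" for M N p
  proof (rule holomorphic2_eqI[where U = "zeta_region M" and W = "zeta_region 0"])
    have sub: "zeta_region M \<subseteq> zeta_region N" by (rule zeta_region_antimono) fact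
    show "holomorphic2_on (\<lambda>p. g M p * h N p) (zeta_region M)" "holomorphic2_on (\<lambda>p. g N p * h M p) (zeta_region M)"
      by (intro holomorphic2_on_mult gh holomorphic2_on_subset[OF gh(1)[of N] open_zeta_region sub]
            holomorphic2_on_subset[OF gh(2)[of N] open_zeta_region sub])+
    show "g M q * h N q = g N q * h M q" if "q \<in> zeta_region 0" for q
      using gh(4)[OF that] by simp
  qed (use p zeta_region_0_open_nonempty connected_zeta_region zeta_region_antimono in auto)
  define idx where "idx = (\<lambda>p. SOME N. p \<in> zeta_region N)"
  have idx: "p \<in> zeta_region (idx p)" for p
    unfolding idx_def using zeta_region_exhausts by (rule someI_ex)
  define f where "f = (\<lambda>p. g (idx p) p / h (idx p) p)"
  have f: "f p = g N p / h N p" if "p \<in> zeta_region N" "p \<in> regular_points" for p N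
  proof -
    have "g (idx p) p * h N p = g N p * h (idx p) p"
      using cross[of p "idx p" N] cross[of p N "idx p"] idx[of p] that(1) by (metis nle_le)
    then show ?thesis using gh(3) that idx by (simp add: f_def frac_eq_eq)
  qed
  have "holomorphic2_on f regular_points"
  proof (rule holomorphic2_on_local)
    fix p assume p: "p \<in> regular_points"
    obtain N where N: "p \<in> zeta_region N" using zeta_region_exhausts by blast
    let ?V = "zeta_region N \<inter> regular_points"
    have "open ?V" using open_zeta_region open_regular_points by blast
    then have "holomorphic2_on (\<lambda>p. g N p / h N p) ?V"
      using gh by (intro holomorphic2_on_divide holomorphic2_on_subset[OF gh(1)] holomorphic2_on_subset[OF gh(2)]) auto
    then show "\<exists>V g. p \<in> V \<and> V \<subseteq> regular_points \<and> holomorphic2_on g V \<and> (\<forall>q\<in>V. f q = g q)"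
      using p N f by (intro exI[of _ ?V] exI[of _ "\<lambda>p. g N p / h N p"]) auto
  qed
  moreover have "\<exists>V g h. open V \<and> connected V \<and> p \<in> V \<and> holomorphic2_on g V \<and> holomorphic2_on h V \<and>
      (\<exists>q\<in>V. h q \<noteq> 0) \<and> (\<forall>q\<in>V \<inter> regular_points. f q * h q = g q)" for p
  proof -
    obtain N where N: "p \<in> zeta_region N" using zeta_region_exhausts by blast
    have "\<exists>q\<in>zeta_region N. h N q \<noteq> 0"
      using zeta_region_0_open_nonempty(2) zeta_region_subset_regular zeta_region_antimono[of 0 N] gh(3)[of _ N]
      by blast
    moreover have "\<forall>q\<in>zeta_region N \<inter> regular_points. f q * h N q = g N q"
      using f gh(3) by auto
    ultimately show ?thesis
      using N gh(1)[of N] gh(2)[of N] open_zeta_region[of N] connected_zeta_region[of N]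
      by (intro exI conjI)
  qed
  ultimately have "meromorphic2 f regular_points"
    unfolding meromorphic2_def using closure_regular_points by blast
  moreover have "f p = F p" if "p \<in> zeta_region 0" for p
    using f[of p 0] gh(3,4)[of p 0] that zeta_region_subset_regular by auto
  moreover have "\<exists>g h. holomorphic2_on g (zeta_region N) \<and> holomorphic2_on h (zeta_region N) \<and>
       (\<forall>p\<in>zeta_region N \<inter> regular_points. h p \<noteq> 0 \<and> f p * h p = g p)" for N
    by (rule exI[of _ "g N"], rule exI[of _ "h N"]) (use gh f in auto)
  ultimately show thesis by (rule that)
qed

section \<open>The zero on the diagonal\<close>

lemma zeta2_eq:
  assumes a: "0 < a" "a \<le> 1" and f: "zeta2_continuation a f D" and s: "(s1, s2) \<in> D"
  shows "zeta2 a s1 s2 = f (s1, s2)"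
  unfolding zeta2_def
proof (rule the_equality)
  show "\<exists>f' D. zeta2_continuation a f' D \<and> (s1, s2) \<in> D \<and> f (s1, s2) = f' (s1, s2)"
    using f s by blast
  fix z assume "\<exists>f D. zeta2_continuation a f D \<and> (s1, s2) \<in> D \<and> z = f (s1, s2)"
  then obtain f' D' where f': "zeta2_continuation a f' D'" "(s1, s2) \<in> D'" "z = f' (s1, s2)" by blast
  note conv = zeta2_abs_conv_eq[OF a]
  have "f' (s1, s2) = f (s1, s2)"
  proof (rule meromorphic2_eqI[where W = "zeta_region 0"])
    show "meromorphic2 f' D'" "meromorphic2 f D" using f f' by (auto simp: zeta2_continuation_def)
    show "zeta_region 0 \<subseteq> D' \<inter> D" using f f' by (auto simp: zeta2_continuation_def conv)
    show "f' p = f p" if "p \<in> zeta_region 0" for p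
      using f f' that by (simp add: zeta2_continuation_def conv case_prod_unfold)
  qed (use zeta_region_0_open_nonempty s f' in auto)
  then show "z = f (s1, s2)" using f' by simp
qed

text \<open>
  The function \<open>(s-1) \<zeta>(s)\<close> on the half-plane \<open>Re s > 0\<close>, in the form that the recursion with \<open>K = 1\<close> gives.
\<close>

definition hurwitz_pole_free :: "real \<Rightarrow> complex \<Rightarrow> complex" where
  "hurwitz_pole_free a s = complex_of_real a powr (1 - s) + (\<Sum>\<^sub>\<infinity>m. taylor_tail 1 s (real m + a))"

lemma hurwitz_pole_free_eq:
  assumes "0 < a" "a \<le> 1" "Re s > 1"
  shows "hurwitz_pole_free a s = (s - 1) * hurwitz_zeta a s"
  using hurwitz_zeta_recursion[OF assms(1,2) order_refl assms(3)] by (simp add: hurwitz_pole_free_def)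

lemma hurwitz_pole_free_holomorphic:
  assumes a: "0 < a" "a \<le> 1"
  shows "hurwitz_pole_free a holomorphic_on {s. Re s > 0}"
proof -
  have "(\<lambda>s. complex_of_real a powr (1 - s)) holomorphic_on {s. Re s > 0}"
    using a by (auto intro!: holomorphic_intros)
  moreover have "(\<lambda>s. \<Sum>\<^sub>\<infinity>m. taylor_tail 1 s (real m + a)) holomorphic_on {s. Re s > 0}"
    using decays_single_holomorphic[OF a decays_taylor_tail[OF a(1)], of 1] by simp
  ultimately show ?thesis unfolding hurwitz_pole_free_def[abs_def] by (rule holomorphic_on_add)
qed

lemma hurwitz_pole_free_at_1:
  assumes "0 < a" shows "hurwitz_pole_free a 1 = 1"
proof -
  have "taylor_tail 1 1 (real m + a) = 0" for m
  proof -
    have "complex_of_real (real m + a + 1) \<noteq> 0" "complex_of_real (real m + a) \<noteq> 0"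
      using assms by (simp_all only: of_real_eq_0_iff)
    then show ?thesis by (simp add: taylor_tail_def del: of_real_add)
  qed
  then show ?thesis using assms by (simp add: hurwitz_pole_free_def)
qed

lemma hurwitz_pole_free_real:
  assumes a: "0 < a" "a \<le> 1" and t: "t > 0"
  shows "hurwitz_pole_free a (complex_of_real t) = complex_of_real (Re (hurwitz_pole_free a (complex_of_real t)))"
proof -
  have pw: "complex_of_real x powr (1 - complex_of_real t) = complex_of_real (x powr (1 - t))" 
    "complex_of_real x powr - complex_of_real t = complex_of_real (x powr - t)" if "x > 0" for x
    using that powr_of_real[of x "1 - t"] powr_of_real[of x "- t"] by simp_all
  have "Im (taylor_tail 1 (complex_of_real t) (real m + a)) = 0" for m
  proof -
    have "real m + a > 0" "real m + a + 1 > 0" using a by auto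
    then show ?thesis by (simp add: taylor_tail_def pw del: of_real_add)
  qed
  moreover have "(\<lambda>m. taylor_tail 1 (complex_of_real t) (real m + a)) summable_on UNIV"
    by (rule decays_single_summable[OF a decays_taylor_tail[OF a(1)]]) (use t in simp)
  ultimately have "Im (\<Sum>\<^sub>\<infinity>m. taylor_tail 1 (complex_of_real t) (real m + a)) = 0"
    by (simp flip: infsum_Im)
  then have "Im (hurwitz_pole_free a (complex_of_real t)) = 0"
    using pw(1)[OF a(1)] by (simp add: hurwitz_pole_free_def)
  then show ?thesis by (simp add: complex_eq_iff)
qed

text \<open>
  At \<open>t = 1/2\<close> only the term with \<open>H (2 * t) = H 1\<close> survives, at \<open>t = 1\<close> only the one with \<open>H t = H 1\<close>;
  they enter with opposite signs, and \<open>H 1 = 1\<close>.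
\<close>

lemma zero_crossing:
  assumes a: "0 < a" "a \<le> 1"
  obtains t :: real where "1/2 < t" "t < 1"
    "hurwitz_pole_free a (of_real t) ^ 2 * (2 * of_real t - 1) = hurwitz_pole_free a (2 * of_real t) * (of_real t - 1) ^ 2"
proof -
  define H where "H = (\<lambda>t::real. Re (hurwitz_pole_free a (of_real t)))"
  define \<phi> where "\<phi> = (\<lambda>t. H t ^ 2 * (2 * t - 1) - H (2 * t) * (t - 1) ^ 2)"
  have H1: "H 1 = 1" using hurwitz_pole_free_at_1[OF a(1)] by (simp add: H_def)
  have contH: "continuous_on {0<..} H"
    unfolding H_def
    by (intro continuous_intros
        continuous_on_compose2[OF holomorphic_on_imp_continuous_on[OF hurwitz_pole_free_holomorphic[OF a]]]) auto
  have "continuous_on {1/2..1} H" using contH by (rule continuous_on_subset) auto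
  moreover have "continuous_on {1/2..1} (\<lambda>t. H (2 * t))"
    by (rule continuous_on_compose2[OF contH]) (auto intro!: continuous_intros)
  ultimately have "continuous_on {1/2..1} \<phi>" unfolding \<phi>_def by (intro continuous_intros)
  moreover have \<phi>0: "\<phi> (1/2) = - 1/4" and \<phi>1: "\<phi> 1 = 1" by (simp_all add: \<phi>_def H1 power2_eq_square)
  ultimately obtain t where t: "1/2 \<le> t" "t \<le> 1" "\<phi> t = 0"
    using IVT'[of \<phi> "1/2" 0 1] by auto
  have "\<phi> (1/2) \<noteq> 0" "\<phi> 1 \<noteq> 0" unfolding \<phi>0 \<phi>1 by auto
  with t(3) have "t \<noteq> 1/2" "t \<noteq> 1" by metis+
  with t have t': "1/2 < t" "t < 1" by auto
  have r: "hurwitz_pole_free a (of_real t) = of_real (H t)" "hurwitz_pole_free a (2 * of_real t) = of_real (H (2 * t))"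
    using hurwitz_pole_free_real[OF a, of t] hurwitz_pole_free_real[OF a, of "2 * t"] t' by (simp_all add: H_def)
  have "H t ^ 2 * (2 * t - 1) = H (2 * t) * (t - 1) ^ 2" using t(3) by (simp add: \<phi>_def)
  then have "complex_of_real (H t ^ 2 * (2 * t - 1)) = complex_of_real (H (2 * t) * (t - 1) ^ 2)" by simp
  then have "hurwitz_pole_free a (of_real t) ^ 2 * (2 * of_real t - 1) = hurwitz_pole_free a (2 * of_real t) * (of_real t - 1) ^ 2"
    unfolding r by simp
  with t' show thesis by (rule that)
qed

text \<open>
  The harmonic product with all denominators cleared: \<open>g / h\<close> is the double zeta function, and
  \<open>z - 1\<close>, \<open>w - 1\<close>, \<open>z + w - 1\<close> are the factors that turn \<open>\<zeta>(z)\<close>, \<open>\<zeta>(w)\<close>, \<open>\<zeta>(z+w)\<close> into holomorphic functions.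
  In this form both sides are holomorphic on the connected set \<open>Re z, Re w > 1/2\<close>.
\<close>

lemma harmonic_product_continued:
  assumes a: "0 < a" "a \<le> 1"
    and g: "holomorphic2_on g (zeta_region 1)" and h: "holomorphic2_on h (zeta_region 1)"
    and gh: "\<And>p. p \<in> zeta_region 0 \<Longrightarrow> g p = h p * (zeta2_star a p - hurwitz_zeta a (fst p + snd p))"
    and s: "Re z > 1/2" "Re w > 1/2"
  shows "h (z, w) * h (w, z) * (hurwitz_pole_free a z * hurwitz_pole_free a w * (z + w - 1)) =
    (g (z, w) * h (w, z) + g (w, z) * h (z, w)) * ((z - 1) * (w - 1) * (z + w - 1)) +
    h (z, w) * h (w, z) * ((z - 1) * (w - 1) * hurwitz_pole_free a (z + w))"
proof -
  define U where "U = {p::complex \<times> complex. Re (fst p) > 1/2 \<and> Re (snd p) > 1/2}"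
  define W where "W = {p::complex \<times> complex. Re (fst p) > 1 \<and> Re (snd p) > 1}"
  have U: "open U" "connected U"
  proof -
    have eq: "U = {z. Re z > 1/2} \<times> {z. Re z > 1/2}" by (auto simp: U_def)
    show "open U" unfolding eq by (intro open_Times open_halfspace_Re_gt)
    show "connected U" unfolding eq by (intro convex_connected convex_Times convex_halfspace_Re_gt)
  qed
  have W: "open W" "W \<noteq> {}" "W \<subseteq> U"
  proof -
    have eq: "W = {z. Re z > 1} \<times> {z. Re z > 1}" by (auto simp: W_def)
    show "open W" unfolding eq by (intro open_Times open_halfspace_Re_gt)
    have "(2, 2) \<in> W" by (simp add: W_def)
    then show "W \<noteq> {}" by blast
  qed (auto simp: W_def U_def)
  have sub: "U \<subseteq> zeta_region 1" "U \<subseteq> {p. (snd p, fst p) \<in> zeta_region 1}"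
    by (auto simp: U_def zeta_region_def)
  note hol = holomorphic2_on_subset[OF g U(1) sub(1)] holomorphic2_on_subset[OF h U(1) sub(1)]
    holomorphic2_on_subset[OF holomorphic2_on_swap[OF g] U(1) sub(2)]
    holomorphic2_on_subset[OF holomorphic2_on_swap[OF h] U(1) sub(2)]
  have aff: "holomorphic2_on (\<lambda>p. f (\<alpha> * fst p + \<beta> * snd p + \<gamma>)) U" if "f holomorphic_on S"
    "\<And>z w. (z, w) \<in> U \<Longrightarrow> \<alpha> * z + \<beta> * w + \<gamma> \<in> S" for f S \<alpha> \<beta> \<gamma>
    using holomorphic2_on_compose_affine[OF that(1) U(1)] that(2) by blast
  have H: "holomorphic2_on (\<lambda>p. hurwitz_pole_free a (fst p)) U" "holomorphic2_on (\<lambda>p. hurwitz_pole_free a (snd p)) U"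
    "holomorphic2_on (\<lambda>p. hurwitz_pole_free a (fst p + snd p)) U"
    using aff[OF hurwitz_pole_free_holomorphic[OF a], of 1 0 0] aff[OF hurwitz_pole_free_holomorphic[OF a], of 0 1 0]
      aff[OF hurwitz_pole_free_holomorphic[OF a], of 1 1 0] by (simp_all add: U_def)
  have L: "holomorphic2_on (\<lambda>p. fst p - 1) U" "holomorphic2_on (\<lambda>p. snd p - 1) U"
    "holomorphic2_on (\<lambda>p. fst p + snd p - 1) U"
    using aff[of "\<lambda>s. s" UNIV 1 0 "-1"] aff[of "\<lambda>s. s" UNIV 0 1 "-1"] aff[of "\<lambda>s. s" UNIV 1 1 "-1"]
    by simp_all
  let ?h = "\<lambda>p. h p * h (snd p, fst p)"
  let ?l = "\<lambda>p. (fst p - 1) * (snd p - 1)"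
  have "?h p * (hurwitz_pole_free a (fst p) * hurwitz_pole_free a (snd p) * (fst p + snd p - 1)) =
    (g p * h (snd p, fst p) + g (snd p, fst p) * h p) * (?l p * (fst p + snd p - 1)) +
    ?h p * (?l p * hurwitz_pole_free a (fst p + snd p))" (is "?lhs p = ?rhs p") if "p \<in> U" for p
  proof (rule holomorphic2_eqI[OF _ _ U(2) W])
    show "holomorphic2_on ?lhs U" "holomorphic2_on ?rhs U"
      by (intro holomorphic2_on_mult holomorphic2_on_add hol H L)+
    show "?lhs p = ?rhs p" if p: "p \<in> W" for p
    proof -
      obtain z w where zw: "p = (z, w)" by (cases p)
      have re: "Re z > 1" "Re w > 1" "Re (z + w) > 1" using p by (auto simp: W_def zw)
      have reg: "(z, w) \<in> zeta_region 0" "(w, z) \<in> zeta_region 0"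
        using re by (auto simp: zeta_region_def)
      define X where "X = zeta2_star a (z, w) - hurwitz_zeta a (z + w)"
      define Y where "Y = zeta2_star a (w, z) - hurwitz_zeta a (z + w)"
      have G: "g (z, w) = h (z, w) * X" "g (w, z) = h (w, z) * Y"
        using gh[OF reg(1)] gh[OF reg(2)] by (simp_all add: X_def Y_def add.commute)
      have prod: "hurwitz_zeta a z * hurwitz_zeta a w = X + Y + hurwitz_zeta a (z + w)"
        using harmonic_product[OF a re(1,2)] by (simp add: X_def Y_def)
      have "hurwitz_pole_free a z * hurwitz_pole_free a w * (z + w - 1) =
          (hurwitz_zeta a z * hurwitz_zeta a w) * ((z - 1) * (w - 1) * (z + w - 1))"
        using hurwitz_pole_free_eq[OF a re(1)] hurwitz_pole_free_eq[OF a re(2)] by simp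
      also have "\<dots> = (X + Y) * ((z - 1) * (w - 1) * (z + w - 1)) +
          (z - 1) * (w - 1) * hurwitz_pole_free a (z + w)"
        unfolding prod hurwitz_pole_free_eq[OF a re(3)] by (simp add: algebra_simps)
      finally have e: "hurwitz_pole_free a z * hurwitz_pole_free a w * (z + w - 1) =
          (X + Y) * ((z - 1) * (w - 1) * (z + w - 1)) + (z - 1) * (w - 1) * hurwitz_pole_free a (z + w)" .
      show ?thesis
        unfolding zw fst_conv snd_conv e G by (simp add: algebra_simps)
    qed
  qed (fact that)
  from this[of "(z, w)"] show ?thesis using s by (simp add: U_def)
qed

theorem proposition1p5:
  fixes a :: real
  assumes "0 < a" and "a \<le> 1"
  shows "(\<exists>\<sigma>::real. 1/2 < \<sigma> \<and> \<sigma> < 1 \<and>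
            (complex_of_real \<sigma>, complex_of_real \<sigma>) \<in> zeta2_domain a \<and>
            zeta2 a (complex_of_real \<sigma>) (complex_of_real \<sigma>) = 0) \<and>
         (\<exists>\<sigma>1 \<sigma>2::real. 1/2 < \<sigma>1 \<and> \<sigma>1 < 1 \<and> 1/2 < \<sigma>2 \<and> \<sigma>2 < 1 \<and>
            (complex_of_real \<sigma>1, complex_of_real \<sigma>2) \<in> zeta2_domain a \<and>
            zeta2 a (complex_of_real \<sigma>1) (complex_of_real \<sigma>2) = 0)"
proof -
  obtain f where f: "meromorphic2 f regular_points"
    "\<And>p. p \<in> zeta_region 0 \<Longrightarrow> f p = zeta2_star a p - hurwitz_zeta a (fst p + snd p)"
    "\<And>N. \<exists>g h. holomorphic2_on g (zeta_region N) \<and> holomorphic2_on h (zeta_region N) \<and>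
       (\<forall>p\<in>zeta_region N \<inter> regular_points. h p \<noteq> 0 \<and> f p * h p = g p)"
    using continuable_imp_meromorphic2[OF continuable_zeta2[OF assms]] by blast
  have cont: "zeta2_continuation a f regular_points"
    unfolding zeta2_continuation_def zeta2_abs_conv_eq[OF assms]
    using f(1,2) zeta_region_subset_regular zeta2_series_eq[OF assms] by auto
  obtain g h where g: "holomorphic2_on g (zeta_region 1)" and h: "holomorphic2_on h (zeta_region 1)"
    and gh: "\<And>p. p \<in> zeta_region 1 \<Longrightarrow> p \<in> regular_points \<Longrightarrow> h p \<noteq> 0 \<and> f p * h p = g p"
    using f(3)[of 1] by blast
  have gh0: "g p = h p * (zeta2_star a p - hurwitz_zeta a (fst p + snd p))" if "p \<in> zeta_region 0" for p
  proof -
    have "p \<in> zeta_region 1" "p \<in> regular_points"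
      using that zeta_region_antimono[of 0 1] zeta_region_subset_regular by auto
    from gh[OF this] f(2)[OF that] show ?thesis by (metis mult.commute)
  qed
  obtain t :: real where t: "1/2 < t" "t < 1" and
    t0: "hurwitz_pole_free a (of_real t) ^ 2 * (2 * of_real t - 1) = hurwitz_pole_free a (2 * of_real t) * (of_real t - 1) ^ 2"
    using zero_crossing[OF assms] .
  define s where "s = complex_of_real t"
  have mem: "(s, s) \<in> zeta_region 1" using t by (simp add: s_def zeta_region_def)
  have reg: "(s, s) \<in> regular_points"
  proof -
    have "complex_of_real x \<notin> \<int>\<^sub>\<le>\<^sub>0" if "-1 < x" "x < 0" for x
    proof
      assume "complex_of_real x \<in> \<int>\<^sub>\<le>\<^sub>0"
      then obtain n :: int where "complex_of_real x = of_int n" by (elim nonpos_Ints_cases)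
      then have "x = of_int n" by (metis of_real_eq_iff of_real_of_int_eq)
      with that show False by simp
    qed
    from this[of "t - 1"] this[of "2 * t - 2"] show ?thesis
      using t by (simp add: regular_points_def s_def)
  qed
  have "h (s, s) * h (s, s) * (hurwitz_pole_free a s * hurwitz_pole_free a s * (s + s - 1)) =
    (g (s, s) * h (s, s) + g (s, s) * h (s, s)) * ((s - 1) * (s - 1) * (s + s - 1)) +
    h (s, s) * h (s, s) * ((s - 1) * (s - 1) * hurwitz_pole_free a (s + s))"
    using t by (intro harmonic_product_continued[OF assms g h gh0]) (auto simp: s_def)
  moreover have "hurwitz_pole_free a s * hurwitz_pole_free a s * (s + s - 1) = (s - 1) * (s - 1) * hurwitz_pole_free a (s + s)"
    using t0 unfolding s_def[symmetric] by (simp add: power2_eq_square mult.commute flip: mult_2)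
  \<comment> \<open>By the choice of \<open>t\<close> the terms of the identity without \<open>g\<close> cancel.\<close>
  ultimately have "2 * g (s, s) * h (s, s) * ((s - 1) * (s - 1) * (2 * s - 1)) = 0"
    by (simp flip: mult_2)
  moreover have "s - 1 \<noteq> 0" "2 * s - 1 \<noteq> 0"
  proof -
    have "Re (s - 1) \<noteq> 0" "Re (2 * s - 1) \<noteq> 0" using t by (auto simp: s_def)
    then show "s - 1 \<noteq> 0" "2 * s - 1 \<noteq> 0" by fastforce+
  qed
  ultimately have "f (s, s) = 0" using gh[OF mem reg] by auto
  then have "zeta2 a s s = 0" using zeta2_eq[OF assms cont reg] by simp
  moreover have "(s, s) \<in> zeta2_domain a" using cont reg unfolding zeta2_domain_def by blast
  ultimately show ?thesis using t unfolding s_def by blast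
qed

end
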